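(* The subspaces $\mathbf{\Pi}^B$ and $\mathbf{\Pi}^D$ are graded sub-coalgebras of $(\textbf{W},\Delta_\odot,\epsilon_\odot)$ and graded right module coalgebras for $(\mathbf{\Pi},\nabla_{\sqcup\!\sqcup},\iota_{\sqcup\!\sqcup},\Delta_\odot,\epsilon_\odot)$.
   Context: Let $\Bbbk$ be a field of characteristic zero. For a word $w=w_1\cdots w_m$ of positive integers with $\max(w)\le n$, $[w,n]$ is the linear endomorphism of the $\Bbbk$-span of all words sending a word $v$ of length $n$ to $v_{w_1}\cdots v_{w_m}$ and others to $0$; $\textbf{W}$ is their span, a graded bialgebra (degree $m$) with product $\nabla_{\sqcup\!\sqcup}([v,m]\otimes[w,n])=[v\sqcup\!\sqcup(w\uparrow m),m+n]$ ($\sqcup\!\sqcup$ the shuffle product of words, $w\uparrow m$ adds $m$ to each letter), unit $\iota_{\sqcup\!\sqcup}(1)=[\emptyset,0]$, coproduct $\Delta_\odot([w,n])=\sum_i[w_1\cdots w_i,n]\otimes[w_{i+1}\cdots w_m,n]$ and counit $\epsilon_\odot([w,n])=1$ if $w=\emptyset$, else $0$. $\mathbf{\Pi}$ is the sub-bialgebra spanned by $[\pi]=\sum_{w\in\mathcal{R}(\pi)}[w,n]$ for $\pi\in S_{n+1}$ with reduced words $\mathcal{R}(\pi)$ for $s_i=(i,i+1)$. $B_n$ is the group of signed permutations of $\{\pm1,\dots,\pm n\}$, generated by $s^B_1=(-1,1)$ and $s^B_i=(-i,-i+1)(i-1,i)$ for $2\le i\le n$; $D_n$ is generated by $s^D_1=s^B_1s^B_2s^B_1$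 and $s^D_i=s^B_i$ for $i\ge2$. For $\pi\in B_n$, $\mathcal{R}^B(\pi)$ and $\mathcal{R}^D(\pi)$ are the sets of reduced words in these generators, $[\pi]_B=\sum_{w\in\mathcal{R}^B(\pi)}[w,n]$ and $[\pi]_D=\sum_{w\in\mathcal{R}^D(\pi)}[w,n]$; $\mathbf{\Pi}^B=\bigoplus_{n\ge1}\operatorname{span}\{[\pi]_B:\pi\in B_n\}$ and $\mathbf{\Pi}^D=\bigoplus_{n\ge2}\operatorname{span}\{[\pi]_D:\pi\in D_n\}$. For a (graded) bialgebra $B$, a (graded) right $B$-module coalgebra is a (graded) coalgebra $M$ which is a right $B$-module such that the multiplication $M\otimes B\to M$ is a (graded) coalgebra morphism; here the action is via $\nabla_{\sqcup\!\sqcup}$. *)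

theory Defs
  imports Complex_Main "HOL-Library.Multiset" "HOL-Library.Function_Algebras" "HOL-Combinatorics.Permutations"
begin

(* The basis element [w,n] of W is represented by the pair (w,n). The [w,n] with
   all letters of w in {1..n} are linearly independent endomorphisms, so an element
   of W is a finitely supported coefficient function on valid pairs. *)
type_synonym wbasis = "nat list \<times> nat"

definition valid_basis :: "wbasis \<Rightarrow> bool" where
  "valid_basis x \<longleftrightarrow> (\<forall>i\<in>set (fst x). 1 \<le> i \<and> i \<le> snd x)"

definition supp :: "('b \<Rightarrow> 'a::zero) \<Rightarrow> 'b set" where
  "supp f = {x. f x \<noteq> 0}"

definition Wsp :: "(wbasis \<Rightarrow> 'a::field_char_0) set" where
  "Wsp = {f. finite (supp f) \<and> (\<forall>x\<in>supp f. valid_basis x)}"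

definition kspan :: "('b \<Rightarrow> 'a::field_char_0) set \<Rightarrow> ('b \<Rightarrow> 'a) set" where
  "kspan S = module.span (\<lambda>c f. (\<lambda>x. c * f x)) S"

definition bas :: "wbasis \<Rightarrow> wbasis \<Rightarrow> 'a::field_char_0" where
  "bas x = (\<lambda>y. if y = x then 1 else 0)"

fun shuffle_ms :: "'b list \<Rightarrow> 'b list \<Rightarrow> 'b list multiset" where
  "shuffle_ms [] ys = {#ys#}"
| "shuffle_ms xs [] = {#xs#}"
| "shuffle_ms (x#xs) (y#ys) =
     image_mset ((#) x) (shuffle_ms xs (y#ys)) + image_mset ((#) y) (shuffle_ms (x#xs) ys)"

definition shift_word :: "nat list \<Rightarrow> nat \<Rightarrow> nat list" where
  "shift_word w m = map (\<lambda>i. i + m) w"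

definition bprod :: "wbasis \<Rightarrow> wbasis \<Rightarrow> wbasis \<Rightarrow> 'a::field_char_0" where
  "bprod x y = (\<lambda>z. if snd z = snd x + snd y
       then of_nat (count (shuffle_ms (fst x) (shift_word (fst y) (snd x))) (fst z)) else 0)"

definition Wmult :: "(wbasis \<Rightarrow> 'a) \<Rightarrow> (wbasis \<Rightarrow> 'a) \<Rightarrow> wbasis \<Rightarrow> 'a::field_char_0" where
  "Wmult f g = (\<lambda>z. \<Sum>x\<in>supp f. \<Sum>y\<in>supp g. f x * g y * bprod x y z)"

definition Wunit :: "wbasis \<Rightarrow> 'a::field_char_0" where
  "Wunit = bas ([], 0)"

(* W \<otimes> W: coefficient functions on pairs of basis elements *)
definition tens :: "(wbasis \<Rightarrow> 'a) \<Rightarrow> (wbasis \<Rightarrow> 'a) \<Rightarrow> wbasis \<times> wbasis \<Rightarrow> 'a::field_char_0" where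
  "tens f g = (\<lambda>(x, y). f x * g y)"

definition bcop :: "wbasis \<Rightarrow> wbasis \<times> wbasis \<Rightarrow> 'a::field_char_0" where
  "bcop x = (\<lambda>(p, q). of_nat (card {i. i \<le> length (fst x) \<and>
       p = (take i (fst x), snd x) \<and> q = (drop i (fst x), snd x)}))"

definition Wcop :: "(wbasis \<Rightarrow> 'a) \<Rightarrow> wbasis \<times> wbasis \<Rightarrow> 'a::field_char_0" where
  "Wcop f = (\<lambda>pq. \<Sum>x\<in>supp f. f x * bcop x pq)"

definition Wcounit :: "(wbasis \<Rightarrow> 'a) \<Rightarrow> 'a::field_char_0" where
  "Wcounit f = (\<Sum>x\<in>supp f. if fst x = [] then f x else 0)"

definition WWmult :: "(wbasis \<times> wbasis \<Rightarrow> 'a) \<Rightarrow> (wbasis \<times> wbasis \<Rightarrow> 'a) \<Rightarrow> wbasis \<times> wbasis \<Rightarrow> 'a::field_char_0" where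
  "WWmult F G = (\<lambda>(u, v). \<Sum>p\<in>supp F. \<Sum>q\<in>supp G.
      F p * G q * bprod (fst p) (fst q) u * bprod (snd p) (snd q) v)"

definition tensor_sp :: "(wbasis \<Rightarrow> 'a) set \<Rightarrow> (wbasis \<Rightarrow> 'a) set \<Rightarrow> (wbasis \<times> wbasis \<Rightarrow> 'a::field_char_0) set" where
  "tensor_sp M N = kspan {tens f g | f g. f \<in> M \<and> g \<in> N}"

definition hcomp :: "nat \<Rightarrow> (wbasis \<Rightarrow> 'a) \<Rightarrow> wbasis \<Rightarrow> 'a::field_char_0" where
  "hcomp d f = (\<lambda>x. if length (fst x) = d then f x else 0)"

definition homog :: "nat \<Rightarrow> (wbasis \<Rightarrow> 'a::field_char_0) \<Rightarrow> bool" where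
  "homog d f \<longleftrightarrow> hcomp d f = f"

definition graded_subspace :: "(wbasis \<Rightarrow> 'a::field_char_0) set \<Rightarrow> bool" where
  "graded_subspace M \<longleftrightarrow> M \<subseteq> Wsp \<and> kspan M = M \<and> (\<forall>f\<in>M. \<forall>d. hcomp d f \<in> M)"

definition graded_subcoalgebra :: "(wbasis \<Rightarrow> 'a::field_char_0) set \<Rightarrow> bool" where
  "graded_subcoalgebra M \<longleftrightarrow> graded_subspace M
     \<and> (\<forall>f\<in>M. Wcop f \<in> tensor_sp M M)
     \<and> (\<forall>f\<in>M. \<forall>d. homog d f \<longrightarrow>
          (\<forall>p q. Wcop f (p, q) \<noteq> 0 \<longrightarrow> length (fst p) + length (fst q) = d))"

definition graded_right_module_coalgebra ::
  "(wbasis \<Rightarrow> 'a::field_char_0) set \<Rightarrow> (wbasis \<Rightarrow> 'a) set \<Rightarrow> bool" where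
  "graded_right_module_coalgebra M B \<longleftrightarrow> graded_subcoalgebra M
     \<and> (\<forall>m\<in>M. \<forall>b\<in>B. Wmult m b \<in> M)
     \<and> (\<forall>m\<in>M. \<forall>b\<in>B. \<forall>b'\<in>B. Wmult (Wmult m b) b' = Wmult m (Wmult b b'))
     \<and> (\<forall>m\<in>M. Wmult m Wunit = m)
     \<and> (\<forall>m\<in>M. \<forall>b\<in>B. \<forall>d e. homog d m \<and> homog e b \<longrightarrow> homog (d + e) (Wmult m b))
     \<and> (\<forall>m\<in>M. \<forall>b\<in>B. Wcop (Wmult m b) = WWmult (Wcop m) (Wcop b))
     \<and> (\<forall>m\<in>M. \<forall>b\<in>B. Wcounit (Wmult m b) = Wcounit m * Wcounit b)"

definition word_prod :: "(nat \<Rightarrow> 'b \<Rightarrow> 'b) \<Rightarrow> nat list \<Rightarrow> 'b \<Rightarrow> 'b" where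
  "word_prod gen w = foldr (\<lambda>i acc. gen i \<circ> acc) w id"

definition reduced_words :: "(nat \<Rightarrow> 'b \<Rightarrow> 'b) \<Rightarrow> nat \<Rightarrow> ('b \<Rightarrow> 'b) \<Rightarrow> nat list set" where
  "reduced_words gen n \<pi> = {w. set w \<subseteq> {1..n} \<and> word_prod gen w = \<pi> \<and>
      (\<forall>v. set v \<subseteq> {1..n} \<and> word_prod gen v = \<pi> \<longrightarrow> length w \<le> length v)}"

definition perm_elem :: "(nat \<Rightarrow> 'b \<Rightarrow> 'b) \<Rightarrow> nat \<Rightarrow> ('b \<Rightarrow> 'b) \<Rightarrow> wbasis \<Rightarrow> 'a::field_char_0" where
  "perm_elem gen n \<pi> = (\<lambda>x. if snd x = n \<and> fst x \<in> reduced_words gen n \<pi> then 1 else 0)"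

definition sA :: "nat \<Rightarrow> nat \<Rightarrow> nat" where
  "sA i = (\<lambda>k. if k = i then i + 1 else if k = i + 1 then i else k)"

definition sB :: "nat \<Rightarrow> int \<Rightarrow> int" where
  "sB i = (if i = 1 then (\<lambda>k. if k = -1 then 1 else if k = 1 then -1 else k)
           else (\<lambda>k. if k = - int i then - int i + 1 else if k = - int i + 1 then - int i
                    else if k = int i - 1 then int i else if k = int i then int i - 1 else k))"

definition sD :: "nat \<Rightarrow> int \<Rightarrow> int" where
  "sD i = (if i = 1 then sB 1 \<circ> sB 2 \<circ> sB 1 else sB i)"

definition Bgrp :: "nat \<Rightarrow> (int \<Rightarrow> int) set" where
  "Bgrp n = {\<pi>. \<pi> permutes {k. k \<noteq> 0 \<and> \<bar>k\<bar> \<le> int n} \<and> (\<forall>k. \<pi> (- k) = - \<pi> k)}"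

definition Dgrp :: "nat \<Rightarrow> (int \<Rightarrow> int) set" where
  "Dgrp n = {word_prod sD w | w. set w \<subseteq> {1..n}}"

definition PiA :: "(wbasis \<Rightarrow> 'a::field_char_0) set" where
  "PiA = kspan {perm_elem sA n \<pi> | n \<pi>. \<pi> permutes {1..n+1}}"

definition PiB :: "(wbasis \<Rightarrow> 'a::field_char_0) set" where
  "PiB = kspan {perm_elem sB n \<pi> | n \<pi>. 1 \<le> n \<and> \<pi> \<in> Bgrp n}"

definition PiD :: "(wbasis \<Rightarrow> 'a::field_char_0) set" where
  "PiD = kspan {perm_elem sD n \<pi> | n \<pi>. 2 \<le> n \<and> \<pi> \<in> Dgrp n}"

end

theory Submission
  imports Defs
begin

text \<open>In coordinates, the coefficient of a word \<open>z\<close> in a product is found by splitting the letters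
  of \<open>z\<close> into low and high ones, so associativity and the compatibility of product and coproduct
  are statements about filtering. The product of \<open>[\<pi>]\<close> with a type A element \<open>[\<sigma>]\<close> is the sum
  of the set \<open>L\<close> of all words whose low part is a reduced word of \<open>\<pi>\<close> and whose shifted high part is a
  reduced word of \<open>\<sigma>\<close>. The set \<open>L\<close> is closed under braid moves and contains no word with two equal
  adjacent letters, so by Tits' word property it is a disjoint union of complete sets of reduced
  words. The word property is derived from the exchange condition, which for signed
  permutations follows by watching where a word reverses the order of a pair of integers.\<close>


section \<open>Spans of coefficient functions\<close>

text \<open>The identities of a module coalgebra hold in all of W, so what is specific to the two
  spans is closure. Closure under the coproduct rests on factors of reduced words being reduced.
  Closure under the product is harder: a word of \<open>L\<close> is glued from pieces reduced in
  two groups of smaller rank, while the claim concerns reduced words of rank \<open>n + k\<close>.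
  Braid moves are the bridge, because they can be tested on the two pieces separately. Two low
  letters braid inside the first piece. Two high letters braid inside the type A piece as soon as
  their braid length is the one of type A. This condition rules out \<open>n = 0\<close>: there the
  letters 1 and 2 would be high, but their braid length is 4 in type B and 2 in type D, against 3 in
  type A. The word property is proved from an abstract descent predicate with checks in rank two, so
  that one argument serves both types.\<close>

interpretation coeff_fun: module "\<lambda>(c::'a::field_char_0) (f::'b \<Rightarrow> 'a). (\<lambda>x. c * f x)"
  by unfold_locales (auto simp: fun_eq_iff algebra_simps)

lemma kspan_base: "f \<in> S \<Longrightarrow> f \<in> kspan S"
  unfolding kspan_def by (rule coeff_fun.span_base)

lemma kspan_zero: "0 \<in> kspan S"
  unfolding kspan_def by (rule coeff_fun.span_zero)

lemma kspan_add: "f \<in> kspan S \<Longrightarrow> g \<in> kspan S \<Longrightarrow> f + g \<in> kspan S"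
  unfolding kspan_def by (rule coeff_fun.span_add)

lemma kspan_scale: "f \<in> kspan S \<Longrightarrow> (\<lambda>x. c * f x) \<in> kspan S"
  unfolding kspan_def by (rule coeff_fun.span_scale)

lemma kspan_sum: "(\<And>i. i \<in> I \<Longrightarrow> F i \<in> kspan S) \<Longrightarrow> (\<Sum>i\<in>I. F i) \<in> kspan S"
  unfolding kspan_def by (rule coeff_fun.span_sum)

lemma kspan_kspan: "kspan (kspan S) = kspan S"
  unfolding kspan_def by (rule coeff_fun.span_span)

text \<open>The remainder \<open>h\<close> keeps its membership in the span because linearity of the
  product and the coproduct is available on \<open>Wsp\<close>, so a step case has to know that
  \<open>h\<close> lies there.\<close>

lemma kspan_induct [consumes 1, case_names zero step]:
  assumes "f \<in> kspan S" "P (\<lambda>_. 0)"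
    "\<And>c g h. g \<in> S \<Longrightarrow> h \<in> kspan S \<Longrightarrow> P h \<Longrightarrow> P (\<lambda>x. c * g x + h x)"
  shows "P f"
proof -
  have "f \<in> kspan S \<and> P f"
    using assms(1)[unfolded kspan_def]
  proof (induction rule: coeff_fun.span_induct_alt)
    case base
    then show ?case using assms(2) kspan_zero by (simp add: zero_fun_def)
  next
    case (step c x y)
    have "(\<lambda>z. c * x z) + y = (\<lambda>z. c * x z + y z)" by (simp add: plus_fun_def)
    moreover have "(\<lambda>z. c * x z) + y \<in> kspan S"
      using step kspan_base[of x S] by (auto intro: kspan_add kspan_scale)
    ultimately show ?case using assms(3) step by auto
  qed
  then show ?thesis ..
qed

lemma kspan_lincomb:
  "f \<in> kspan S \<Longrightarrow> g \<in> kspan S \<Longrightarrow> (\<lambda>x. c * f x + g x) \<in> kspan S"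
  using kspan_add[OF kspan_scale[of f S c], of g] by (simp add: plus_fun_def)

lemma Wsp_lincomb:
  assumes "f \<in> Wsp" "g \<in> Wsp" shows "(\<lambda>x. c * f x + g x) \<in> Wsp"
proof -
  have "supp (\<lambda>x. c * f x + g x) \<subseteq> supp f \<union> supp g" by (auto simp: supp_def)
  then show ?thesis using assms unfolding Wsp_def
    by (auto intro: finite_subset)
qed

lemma zero_in_Wsp: "(\<lambda>_. 0) \<in> Wsp"
  by (simp add: Wsp_def supp_def)

lemma kspan_subset_Wsp: "S \<subseteq> Wsp \<Longrightarrow> kspan S \<subseteq> Wsp"
proof
  fix f assume S: "S \<subseteq> Wsp" and "f \<in> kspan S"
  from this(2) show "f \<in> Wsp"
    by (induction rule: kspan_induct) (use S in \<open>auto intro!: Wsp_lincomb zero_in_Wsp\<close>)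
qed

section \<open>The product and coproduct of W in coordinates\<close>

definition low_part :: "nat \<Rightarrow> nat list \<Rightarrow> nat list" where
  "low_part m z = filter (\<lambda>i. i \<le> m) z"

definition high_part :: "nat \<Rightarrow> nat list \<Rightarrow> nat list" where
  "high_part m z = map (\<lambda>i. i - m) (filter (\<lambda>i. m < i) z)"

lemma low_part_append [simp]: "low_part m (p @ q) = low_part m p @ low_part m q"
  by (simp add: low_part_def)

lemma high_part_append [simp]: "high_part m (p @ q) = high_part m p @ high_part m q"
  by (simp add: high_part_def)

lemma length_low_high: "length (low_part m z) + length (high_part m z) = length z"
  unfolding low_part_def high_part_def
  by (induction z) auto

text \<open>Together with the next two identities: cutting the alphabet at two thresholds, in either
  order, yields the same low, middle and high parts. This is the content of associativity.\<close>

lemma low_part_low_part: "m \<le> M \<Longrightarrow> low_part m (low_part M z) = low_part m z"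
  unfolding low_part_def by (induction z) auto

lemma high_part_low_part: "high_part m (low_part (m + j) z) = low_part j (high_part m z)"
  unfolding low_part_def high_part_def by (induction z) auto

lemma high_part_high_part: "high_part j (high_part m z) = high_part (m + j) z"
  unfolding high_part_def by (induction z) auto

text \<open>Over disjoint alphabets a word can be unshuffled in one way only, so no multiplicity
  exceeds one.\<close>

lemma count_shuffle_disjoint:
  assumes "\<forall>i\<in>set u. P i" "\<forall>i\<in>set v. \<not> P i"
  shows "count (shuffle_ms u v) z = (if filter P z = u \<and> filter (\<lambda>i. \<not> P i) z = v then 1 else 0)"
  using assms
proof (induction u v arbitrary: z rule: shuffle_ms.induct)
  case (1 ys)
  have "ys = z \<longleftrightarrow> filter P z = [] \<and> filter (\<lambda>i. \<not> P i) z = ys"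
    using 1 by (auto simp: filter_id_conv filter_empty_conv)
  then show ?case by auto
next
  case (2 x xs)
  have "x # xs = z \<longleftrightarrow> filter P z = x # xs \<and> filter (\<lambda>i. \<not> P i) z = []"
    using 2 by (auto simp: filter_id_conv filter_empty_conv)
  then show ?case by auto
next
  case (3 x xs y ys)
  have Cons: "count (image_mset ((#) a) M) (b # w) = (if a = b then count M w else 0)"
    and Nil: "count (image_mset ((#) a) M) [] = 0" for a b :: 'a and M w
    by (induction M) auto
  show ?case
  proof (cases z)
    case Nil
    then show ?thesis by (simp add: \<open>\<And>M a. count (image_mset ((#) a) M) [] = 0\<close>)
  next
    case (Cons b w)
    show ?thesis using 3 unfolding Cons
      by (auto simp: \<open>\<And>w b a M. count (image_mset ((#) a) M) (b # w) = _\<close>)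
  qed
qed

text \<open>Validity separates the alphabets: the letters of the first word are at most
  \<open>snd x\<close>, and those of the second are at least 1 and hence exceed \<open>snd x\<close>
  after the shift.\<close>

lemma bprod_valid:
  assumes "valid_basis x" "valid_basis y"
  shows "bprod x y (z, N) =
    (if N = snd x + snd y \<and> low_part (snd x) z = fst x \<and> high_part (snd x) z = fst y then 1 else 0)"
proof -
  have "count (shuffle_ms (fst x) (shift_word (fst y) (snd x))) z =
    (if filter (\<lambda>i. i \<le> snd x) z = fst x \<and>
        filter (\<lambda>i. \<not> i \<le> snd x) z = shift_word (fst y) (snd x) then 1 else 0)"
    by (rule count_shuffle_disjoint) (use assms in \<open>auto simp: valid_basis_def shift_word_def\<close>)
  moreover have "filter (\<lambda>i. \<not> i \<le> k) z = shift_word v k \<longleftrightarrow> high_part k z = v" for k v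
  proof -
    have "map (\<lambda>i. i + k) (map (\<lambda>i. i - k) (filter (\<lambda>i. k < i) z)) = filter (\<lambda>i. k < i) z"
      by (auto intro!: map_idI)
    moreover have "map (\<lambda>i. i - k) (map (\<lambda>i. i + k) v) = v"
      by (auto intro!: map_idI)
    ultimately show ?thesis unfolding high_part_def shift_word_def not_le by metis
  qed
  ultimately show ?thesis
    by (auto simp: bprod_def low_part_def)
qed

lemma sum_supp_delta:
  fixes f :: "'b \<Rightarrow> 'a::comm_semiring_1"
  assumes "finite (supp f)"
  shows "(\<Sum>x\<in>supp f. if x = a then f x * h x else 0) = f a * h a"
  using assms by (auto simp: supp_def)

text \<open>For a fixed word and a fixed cut \<open>m\<close> a single pair of basis elements can
  contribute, so the double sum over supports collapses to a convolution over the cut.\<close>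

lemma Wmult_eq:
  fixes f g :: "wbasis \<Rightarrow> 'a::field_char_0"
  assumes "f \<in> Wsp" "g \<in> Wsp"
  shows "Wmult f g (z, N) = (\<Sum>m\<le>N. f (low_part m z, m) * g (high_part m z, N - m))"
proof -
  have fin: "finite (supp f)" "finite (supp g)"
    and val: "\<And>x. x \<in> supp f \<Longrightarrow> valid_basis x" "\<And>x. x \<in> supp g \<Longrightarrow> valid_basis x"
    using assms by (auto simp: Wsp_def)
  have "Wmult f g (z, N) = (\<Sum>x\<in>supp f. \<Sum>y\<in>supp g. \<Sum>m\<le>N.
      if x = (low_part m z, m) then
        (if y = (high_part m z, N - m) then g y * f x else 0) else 0)"
    unfolding Wmult_def
  proof (intro sum.cong refl)
    fix x y assume xy: "x \<in> supp f" "y \<in> supp g"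
    have "(\<Sum>m\<le>N. if x = (low_part m z, m) then
        (if y = (high_part m z, N - m) then g y * f x else 0) else 0)
      = (\<Sum>m\<le>N. if m = snd x then
        (if N = snd x + snd y \<and> low_part (snd x) z = fst x \<and> high_part (snd x) z = fst y then g y * f x else 0) else 0)"
      by (rule sum.cong) (auto simp: prod_eq_iff)
    then show "f x * g y * bprod x y (z, N) = (\<Sum>m\<le>N. if x = (low_part m z, m) then
        (if y = (high_part m z, N - m) then g y * f x else 0) else 0)"
      using bprod_valid[OF val(1)[OF xy(1)] val(2)[OF xy(2)], where 'a='a]
      by (auto simp: sum.delta)
  qed
  also have "\<dots> = (\<Sum>m\<le>N. \<Sum>x\<in>supp f. \<Sum>y\<in>supp g.
      if x = (low_part m z, m) then
        (if y = (high_part m z, N - m) then g y * f x else 0) else 0)"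
    by (simp only: sum.swap[of _ "{..N}"])
  also have "\<dots> = (\<Sum>m\<le>N. f (low_part m z, m) * g (high_part m z, N - m))"
  proof (intro sum.cong refl)
    fix m
    have "(\<Sum>x\<in>supp f. \<Sum>y\<in>supp g. if x = (low_part m z, m) then
        (if y = (high_part m z, N - m) then g y * f x else 0) else 0)
      = (\<Sum>x\<in>supp f. if x = (low_part m z, m) then f x * g (high_part m z, N - m) else 0)"
      by (rule sum.cong) (auto simp: sum_supp_delta[OF fin(2)] mult.commute)
    also have "\<dots> = f (low_part m z, m) * g (high_part m z, N - m)"
      by (rule sum_supp_delta[OF fin(1)])
    finally show "(\<Sum>x\<in>supp f. \<Sum>y\<in>supp g. if x = (low_part m z, m) then
        (if y = (high_part m z, N - m) then g y * f x else 0) else 0) =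
       f (low_part m z, m) * g (high_part m z, N - m)" .
  qed
  finally show ?thesis .
qed

text \<open>The pair \<open>(p, q)\<close> arises only from the word \<open>p @ q\<close>, cut at
  position \<open>length p\<close>.\<close>

lemma Wcop_eq:
  fixes f :: "wbasis \<Rightarrow> 'a::field_char_0"
  assumes "finite (supp f)"
  shows "Wcop f ((p, n), (q, n')) = (if n = n' then f (p @ q, n) else 0)"
proof -
  have "bcop x ((p, n), (q, n')) = (if n = n' \<and> x = (p @ q, n) then 1 else (0::'a))" for x
  proof -
    have "{i. i \<le> length (fst x) \<and> (p, n) = (take i (fst x), snd x) \<and> (q, n') = (drop i (fst x), snd x)}
      = (if n = n' \<and> x = (p @ q, n) then {length p} else {})"
      by (cases x) (auto dest: arg_cong[of _ _ length])
    then show ?thesis by (simp add: bcop_def)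
  qed
  then have "Wcop f ((p, n), (q, n')) = (\<Sum>x\<in>supp f. if x = (p @ q, n) then f x * (if n = n' then 1 else 0) else 0)"
    unfolding Wcop_def by (intro sum.cong) auto
  also have "\<dots> = (if n = n' then f (p @ q, n) else 0)"
    by (subst sum_supp_delta[OF assms]) auto
  finally show ?thesis .
qed

section \<open>Bounded supports, associativity, unit and grading\<close>

lemma finite_words_bounded: "finite {w :: nat list. set w \<subseteq> {1..n} \<and> length w \<le> d}"
  by (rule finite_lists_length_le) simp

text \<open>Finite support on valid pairs amounts to uniform bounds on word length and rank; such
  bounds simply add up under products.\<close>

lemma WspI:
  assumes "\<And>w n. f (w, n) \<noteq> 0 \<Longrightarrow> set w \<subseteq> {1..n} \<and> length w \<le> d \<and> n \<le> N"
  shows "f \<in> Wsp"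
proof -
  have "supp f \<subseteq> {w. set w \<subseteq> {1..N} \<and> length w \<le> d} \<times> {..N}"
    using assms by (fastforce simp: supp_def)
  moreover have "finite ({w. set w \<subseteq> {1..N} \<and> length w \<le> d} \<times> {..N})"
    by (intro finite_cartesian_product finite_words_bounded) auto
  ultimately have "finite (supp f)" by (rule finite_subset)
  then show ?thesis using assms by (fastforce simp: Wsp_def supp_def valid_basis_def)
qed

lemma WspE:
  assumes "f \<in> Wsp"
  obtains d N where "\<And>w n. f (w, n) \<noteq> 0 \<Longrightarrow> set w \<subseteq> {1..n} \<and> length w \<le> d \<and> n \<le> N"
proof
  fix w n assume *: "f (w, n) \<noteq> 0"
  then have "(w, n) \<in> supp f" by (simp add: supp_def)
  moreover have "finite (supp f)" using assms by (simp add: Wsp_def)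
  ultimately have "length w \<le> Max ((length \<circ> fst) ` supp f)" "n \<le> Max (snd ` supp f)"
    by (auto intro!: Max_ge image_eqI[of _ _ "(w, n)"])
  then show "set w \<subseteq> {1..n} \<and> length w \<le> Max ((length \<circ> fst) ` supp f) \<and> n \<le> Max (snd ` supp f)"
    using assms \<open>(w, n) \<in> supp f\<close> by (fastforce simp: Wsp_def valid_basis_def)
qed

lemma set_subset_low_high:
  assumes "set (low_part m z) \<subseteq> {1..m}" "set (high_part m z) \<subseteq> {1..k}"
  shows "set z \<subseteq> {1..m + k}"
proof
  fix i assume "i \<in> set z"
  then have "i \<in> set (low_part m z) \<or> m < i \<and> i - m \<in> set (high_part m z)"
    by (auto simp: low_part_def high_part_def)
  then show "i \<in> {1..m + k}" using assms by fastforce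
qed

lemma Wmult_in_Wsp:
  assumes f: "f \<in> Wsp" and g: "g \<in> Wsp" shows "Wmult f g \<in> Wsp"
proof -
  from f obtain d N where 1: "\<And>w n. f (w, n) \<noteq> 0 \<Longrightarrow> set w \<subseteq> {1..n} \<and> length w \<le> d \<and> n \<le> N"
    by (rule WspE) auto
  from g obtain e M where 2: "\<And>w n. g (w, n) \<noteq> 0 \<Longrightarrow> set w \<subseteq> {1..n} \<and> length w \<le> e \<and> n \<le> M"
    by (rule WspE) auto
  show ?thesis
  proof (rule WspI)
    fix z K assume "Wmult f g (z, K) \<noteq> 0"
    then obtain m where m: "m \<le> K" "f (low_part m z, m) \<noteq> 0" "g (high_part m z, K - m) \<noteq> 0"
      unfolding Wmult_eq[OF f g] by (auto elim!: sum.not_neutral_contains_not_neutral)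
    show "set z \<subseteq> {1..K} \<and> length z \<le> d + e \<and> K \<le> N + M"
      using 1[OF m(2)] 2[OF m(3)] length_low_high[of m z] m(1)
        set_subset_low_high[of m z "K - m"] by auto
  qed
qed

lemma Wmult_assoc:
  assumes f: "f \<in> Wsp" and g: "g \<in> Wsp" and h: "h \<in> Wsp"
  shows "Wmult (Wmult f g) h = Wmult f (Wmult g h)"
proof
  fix x :: wbasis
  obtain z N where x: "x = (z, N)" by (cases x)
  let ?t = "\<lambda>m j. f (low_part m z, m) * g (low_part j (high_part m z), j)
      * h (high_part (m + j) z, N - (m + j))"
  have "Wmult (Wmult f g) h (z, N) = (\<Sum>M\<le>N. \<Sum>m\<le>M. ?t m (M - m))"
    unfolding Wmult_eq[OF Wmult_in_Wsp[OF f g] h] Wmult_eq[OF f g] sum_distrib_right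
    by (intro sum.cong refl)
      (simp add: low_part_low_part high_part_low_part[of _ "_ - _", symmetric])
  \<comment> \<open>Both sides sum over two cut points; the reindexing replaces the pair
    \<open>m \<le> M\<close> by \<open>m\<close> and the width \<open>j = M - m\<close> of the
    middle block.\<close>
  also have "\<dots> = (\<Sum>m\<le>N. \<Sum>j\<le>N - m. ?t m j)"
    unfolding sum.Sigma[OF finite_atMost ballI[OF finite_atMost]]
    by (rule sum.reindex_bij_witness[of _ "\<lambda>(m, j). (m + j, m)" "\<lambda>(M, m). (m, M - m)"]) auto
  also have "\<dots> = Wmult f (Wmult g h) (z, N)"
    unfolding Wmult_eq[OF f Wmult_in_Wsp[OF g h]] Wmult_eq[OF g h] sum_distrib_left
    by (intro sum.cong refl) (simp add: high_part_high_part mult.assoc)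
  finally show "Wmult (Wmult f g) h x = Wmult f (Wmult g h) x" by (simp add: x)
qed

lemma Wunit_in_Wsp: "Wunit \<in> Wsp"
  by (rule WspI[of _ 0 0]) (auto simp: Wunit_def bas_def split: if_splits)

lemma Wmult_Wunit:
  assumes f: "f \<in> Wsp" shows "Wmult f Wunit = f"
proof
  fix x :: wbasis
  obtain z N where x: "x = (z, N)" by (cases x)
  have "Wmult f Wunit (z, N) = (\<Sum>m\<le>N. if m = N then (if high_part N z = [] then f (low_part N z, N) else 0) else 0)"
    unfolding Wmult_eq[OF f Wunit_in_Wsp] by (rule sum.cong) (auto simp: Wunit_def bas_def)
  also have "\<dots> = (if high_part N z = [] then f (low_part N z, N) else 0)" by simp
  also have "\<dots> = f (z, N)"
  proof (cases "high_part N z = []")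
    case True
    then have "low_part N z = z"
      by (auto simp: high_part_def low_part_def filter_empty_conv filter_id_conv)
    then show ?thesis using True by simp
  next
    \<comment> \<open>A letter above \<open>N\<close> makes \<open>(z, N)\<close> invalid, so both
      sides vanish.\<close>
    case False
    then have "\<not> valid_basis (z, N)"
      by (force simp: high_part_def filter_empty_conv valid_basis_def)
    then show ?thesis using f False by (auto simp: Wsp_def supp_def)
  qed
  finally show "Wmult f Wunit x = f x" by (simp add: x)
qed

lemma homog_iff: "homog d f \<longleftrightarrow> (\<forall>w n. f (w, n) \<noteq> 0 \<longrightarrow> length w = d)"
  by (auto simp: homog_def hcomp_def fun_eq_iff)

lemma homog_Wmult:
  assumes f: "f \<in> Wsp" and g: "g \<in> Wsp" and "homog d f" "homog e g"
  shows "homog (d + e) (Wmult f g)"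
  unfolding homog_iff
proof (intro allI impI)
  fix z K assume "Wmult f g (z, K) \<noteq> 0"
  then obtain m where m: "f (low_part m z, m) \<noteq> 0" "g (high_part m z, K - m) \<noteq> 0"
    unfolding Wmult_eq[OF f g] by (auto elim!: sum.not_neutral_contains_not_neutral)
  then show "length z = d + e"
    using assms(3,4) length_low_high[of m z] unfolding homog_iff by metis
qed

section \<open>The product on the tensor square and its compatibility with the coproduct\<close>

lemma WWmult_eq:
  fixes F G :: "wbasis \<times> wbasis \<Rightarrow> 'a::field_char_0"
  assumes fin: "finite (supp F)" "finite (supp G)"
    and val: "\<And>x. x \<in> supp F \<Longrightarrow> valid_basis (fst x) \<and> valid_basis (snd x)"
      "\<And>x. x \<in> supp G \<Longrightarrow> valid_basis (fst x) \<and> valid_basis (snd x)"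
  shows "WWmult F G ((p, N), (q, N')) = (\<Sum>m\<le>N. \<Sum>m'\<le>N'.
    F ((low_part m p, m), (low_part m' q, m')) * G ((high_part m p, N - m), (high_part m' q, N' - m')))"
proof -
  let ?l = "\<lambda>m m'. ((low_part m p, m), (low_part m' q, m'))"
  let ?h = "\<lambda>m m'. ((high_part m p, N - m), (high_part m' q, N' - m'))"
  let ?t = "\<lambda>x y m m'. if x = ?l m m' then (if y = ?h m m' then G y * F x else 0) else 0"
  have "WWmult F G ((p, N), (q, N')) = (\<Sum>x\<in>supp F. \<Sum>y\<in>supp G. \<Sum>(m, m')\<in>{..N}\<times>{..N'}. ?t x y m m')"
    unfolding WWmult_def prod.case
  proof (intro sum.cong refl)
    fix x y assume xy: "x \<in> supp F" "y \<in> supp G"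
    let ?c = "N = snd (fst x) + snd (fst y) \<and> low_part (snd (fst x)) p = fst (fst x) \<and> high_part (snd (fst x)) p = fst (fst y)
      \<and> N' = snd (snd x) + snd (snd y) \<and> low_part (snd (snd x)) q = fst (snd x) \<and> high_part (snd (snd x)) q = fst (snd y)"
    have "(\<Sum>(m, m')\<in>{..N}\<times>{..N'}. ?t x y m m')
      = (\<Sum>k\<in>{..N}\<times>{..N'}. if k = (snd (fst x), snd (snd x)) then (if ?c then G y * F x else 0) else 0)"
      by (rule sum.cong) (auto simp: prod_eq_iff)
    also have "\<dots> = (if ?c then G y * F x else 0)"
      by (subst sum.delta) auto
    finally show "F x * G y * bprod (fst x) (fst y) (p, N) * bprod (snd x) (snd y) (q, N')
      = (\<Sum>(m, m')\<in>{..N}\<times>{..N'}. ?t x y m m')"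
      using val(1)[OF xy(1)] val(2)[OF xy(2)] by (simp add: bprod_valid)
  qed
  also have "\<dots> = (\<Sum>k\<in>{..N}\<times>{..N'}. \<Sum>x\<in>supp F. \<Sum>y\<in>supp G. ?t x y (fst k) (snd k))"
    by (simp only: sum.swap[of _ "{..N}\<times>{..N'}"] case_prod_unfold)
  also have "\<dots> = (\<Sum>k\<in>{..N}\<times>{..N'}. F (?l (fst k) (snd k)) * G (?h (fst k) (snd k)))"
  proof (intro sum.cong refl)
    fix k
    have "(\<Sum>x\<in>supp F. \<Sum>y\<in>supp G. ?t x y (fst k) (snd k))
      = (\<Sum>x\<in>supp F. if x = ?l (fst k) (snd k) then F x * G (?h (fst k) (snd k)) else 0)"
      by (rule sum.cong) (auto simp: sum_supp_delta[OF fin(2)] mult.commute)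
    then show "(\<Sum>x\<in>supp F. \<Sum>y\<in>supp G. ?t x y (fst k) (snd k))
       = F (?l (fst k) (snd k)) * G (?h (fst k) (snd k))"
      using sum_supp_delta[OF fin(1)] by simp
  qed
  also have "\<dots> = (\<Sum>m\<le>N. \<Sum>m'\<le>N'. F (?l m m') * G (?h m m'))"
    by (simp add: sum.cartesian_product case_prod_unfold)
  finally show ?thesis .
qed

lemma Wcop_supp:
  assumes "f \<in> Wsp"
  shows "finite (supp (Wcop f))"
    and "x \<in> supp (Wcop f) \<Longrightarrow> valid_basis (fst x) \<and> valid_basis (snd x)"
proof -
  have fin: "finite (supp f)" using assms by (simp add: Wsp_def)
  from assms obtain d N where b: "\<And>w n. f (w, n) \<noteq> 0 \<Longrightarrow> set w \<subseteq> {1..n} \<and> length w \<le> d \<and> n \<le> N"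
    by (rule WspE) auto
  have *: "set p \<subseteq> {1..n} \<and> set q \<subseteq> {1..n} \<and> n' = n \<and> n \<le> N \<and> length p \<le> d \<and> length q \<le> d"
    if "Wcop f ((p, n), (q, n')) \<noteq> 0" for p n q n'
    using b[of "p @ q" n] that by (auto simp: Wcop_eq[OF fin] split: if_splits)
  let ?A = "{w. set w \<subseteq> {1..N} \<and> length w \<le> d} \<times> {..N}"
  have "supp (Wcop f) \<subseteq> ?A \<times> ?A" using * by (fastforce simp: supp_def)
  then show "finite (supp (Wcop f))"
    by (rule finite_subset) (intro finite_cartesian_product finite_words_bounded finite_atMost)
  show "valid_basis (fst x) \<and> valid_basis (snd x)" if "x \<in> supp (Wcop f)"
  proof -
    obtain p n q n' where x: "x = ((p, n), (q, n'))" by (metis surj_pair)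
    with that have "Wcop f ((p, n), (q, n')) \<noteq> 0" by (simp add: supp_def)
    from *[OF this] show ?thesis by (auto simp: x valid_basis_def)
  qed
qed

text \<open>On the right the two tensor legs have independent cuts \<open>m\<close> and
  \<open>m'\<close>, but a coproduct is supported on pairs of equal rank, which forces
  \<open>m' = m\<close>. Cutting the alphabet then commutes with concatenating the two
  words.\<close>

lemma Wcop_Wmult:
  assumes f: "f \<in> Wsp" and g: "g \<in> Wsp"
  shows "Wcop (Wmult f g) = WWmult (Wcop f) (Wcop g)"
proof
  fix x :: "wbasis \<times> wbasis"
  obtain p N q N' where x: "x = ((p, N), (q, N'))" by (metis surj_pair)
  have fin: "finite (supp f)" "finite (supp g)" "finite (supp (Wmult f g))"
    using f g Wmult_in_Wsp[OF f g] by (auto simp: Wsp_def)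
  have "WWmult (Wcop f) (Wcop g) x = (\<Sum>m\<le>N. \<Sum>m'\<le>N'. if m' = m then
      (if N = N' then f (low_part m (p @ q), m) * g (high_part m (p @ q), N - m) else 0) else 0)"
    unfolding x WWmult_eq[OF Wcop_supp(1)[OF f] Wcop_supp(1)[OF g] Wcop_supp(2)[OF f] Wcop_supp(2)[OF g], simplified]
    by (intro sum.cong refl) (auto simp: Wcop_eq fin)
  also have "\<dots> = (\<Sum>m\<le>N. if N = N' then f (low_part m (p @ q), m) * g (high_part m (p @ q), N - m) else 0)"
    by (intro sum.cong refl) auto
  also have "\<dots> = Wcop (Wmult f g) x"
    by (simp add: x Wcop_eq fin Wmult_eq[OF f g] del: low_part_append high_part_append)
  finally show "Wcop (Wmult f g) x = WWmult (Wcop f) (Wcop g) x" ..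
qed

section \<open>The counit\<close>

lemma Wcounit_eq:
  assumes f: "f \<in> Wsp" and K: "\<And>n. K \<le> n \<Longrightarrow> f ([], n) = 0"
  shows "Wcounit f = (\<Sum>n<K. f ([], n))"
proof -
  have fin: "finite (supp f)" using f by (simp add: Wsp_def)
  have "Wcounit f = (\<Sum>x\<in>{x\<in>supp f. fst x = []}. f x)"
    unfolding Wcounit_def using fin by (simp add: sum.inter_filter)
  also have "\<dots> = (\<Sum>x\<in>(\<lambda>n. ([], n)) ` {..<K}. f x)"
    using K fin by (intro sum.mono_neutral_left) (force simp: supp_def not_le[symmetric])+
  also have "\<dots> = (\<Sum>n<K. f ([], n))" by (subst sum.reindex) (auto intro: inj_onI)
  finally show ?thesis .
qed

lemma Wcounit_Wmult:
  assumes f: "f \<in> Wsp" and g: "g \<in> Wsp"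
  shows "Wcounit (Wmult f g) = Wcounit f * Wcounit g"
proof -
  from f obtain d N where 1: "\<And>w n. f (w, n) \<noteq> 0 \<Longrightarrow> set w \<subseteq> {1..n} \<and> length w \<le> d \<and> n \<le> N"
    by (rule WspE) auto
  from g obtain e M where 2: "\<And>w n. g (w, n) \<noteq> 0 \<Longrightarrow> set w \<subseteq> {1..n} \<and> length w \<le> e \<and> n \<le> M"
    by (rule WspE) auto
  let ?K = "Suc (N + M)"
  have z: "f ([], n) = 0" if "N < n" for n using 1[of "[]" n] that by auto
  have z': "g ([], n) = 0" if "M < n" for n using 2[of "[]" n] that by auto
  have fg: "Wmult f g ([], n) = (\<Sum>m\<le>n. f ([], m) * g ([], n - m))" for n
    by (simp add: Wmult_eq[OF f g] low_part_def high_part_def)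
  have "Wcounit (Wmult f g) = (\<Sum>n<?K. \<Sum>m\<le>n. f ([], m) * g ([], n - m))"
  proof (subst Wcounit_eq[OF Wmult_in_Wsp[OF f g], of ?K])
    fix n assume "?K \<le> n"
    then have "f ([], m) = 0 \<or> g ([], n - m) = 0" for m
      using z[of m] z'[of "n - m"] by linarith
    then show "Wmult f g ([], n) = 0" unfolding fg by (intro sum.neutral) auto
  qed (simp add: fg)
  also have "\<dots> = (\<Sum>(i, j)\<in>{(i, j). i + j < ?K}. f ([], i) * g ([], j))"
    by (rule sum.triangle_reindex[symmetric])
  \<comment> \<open>The rectangle lies inside the triangle since \<open>?K = Suc (N + M)\<close>,
    and outside the rectangle one of the two factors is zero.\<close>
  also have "\<dots> = (\<Sum>(i, j)\<in>{..<Suc N} \<times> {..<Suc M}. f ([], i) * g ([], j))"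
  proof (rule sum.mono_neutral_right)
    show "finite {(i, j). i + j < ?K}"
      by (rule finite_subset[of _ "{..?K} \<times> {..?K}"]) auto
  qed (use z z' in \<open>auto simp: not_less less_Suc_eq_le not_le[symmetric]\<close>)
  also have "\<dots> = (\<Sum>i<Suc N. f ([], i)) * (\<Sum>j<Suc M. g ([], j))"
    by (simp only: sum_product sum.cartesian_product)
  also have "\<dots> = Wcounit f * Wcounit g"
    using Wcounit_eq[OF f, of "Suc N"] Wcounit_eq[OF g, of "Suc M"] z z' by auto
  finally show ?thesis .
qed


section \<open>Reduced words\<close>

lemma word_prod_Nil [simp]: "word_prod gen [] = id"
  by (simp add: word_prod_def)

lemma word_prod_Cons [simp]: "word_prod gen (i # w) = gen i \<circ> word_prod gen w"
  by (simp add: word_prod_def)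

lemma word_prod_append [simp]: "word_prod gen (u @ v) = word_prod gen u \<circ> word_prod gen v"
  by (induction u) (auto simp: comp_assoc)

lemma reduced_wordsD:
  assumes "w \<in> reduced_words gen n \<pi>"
  shows "set w \<subseteq> {1..n}" "word_prod gen w = \<pi>"
    "\<And>v. set v \<subseteq> {1..n} \<Longrightarrow> word_prod gen v = \<pi> \<Longrightarrow> length w \<le> length v"
  using assms by (auto simp: reduced_words_def)

lemma reduced_words_same_length:
  "u \<in> reduced_words gen n \<pi> \<Longrightarrow> v \<in> reduced_words gen n \<pi> \<Longrightarrow> length u = length v"
  by (metis reduced_wordsD le_antisym)

lemma reduced_words_replace:
  assumes "u \<in> reduced_words gen n \<pi>" "set v \<subseteq> {1..n}" "word_prod gen v = \<pi>" "length v \<le> length u"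
  shows "v \<in> reduced_words gen n \<pi>"
  using assms unfolding reduced_words_def by (auto intro: le_trans)

lemma reduced_words_exist:
  assumes "set w \<subseteq> {1..n}"
  obtains v where "v \<in> reduced_words gen n (word_prod gen w)"
proof -
  obtain v where "(set v \<subseteq> {1..n} \<and> word_prod gen v = word_prod gen w) \<and>
      (\<forall>u. set u \<subseteq> {1..n} \<and> word_prod gen u = word_prod gen w \<longrightarrow> length v \<le> length u)"
    using ex_has_least_nat[of "\<lambda>v. set v \<subseteq> {1..n} \<and> word_prod gen v = word_prod gen w" w length] assms
    by auto
  then show ?thesis by (intro that[of v]) (auto simp: reduced_words_def)
qed

text \<open>A shorter word for the factor would shorten the whole word.\<close>

lemma reduced_words_factor:
  assumes "p @ q @ r \<in> reduced_words gen n \<pi>"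
  shows "q \<in> reduced_words gen n (word_prod gen q)"
proof -
  have "length q \<le> length v" if "set v \<subseteq> {1..n}" "word_prod gen v = word_prod gen q" for v
    using reduced_wordsD(1,2)[OF assms] reduced_wordsD(3)[OF assms, of "p @ v @ r"] that by auto
  then show ?thesis using reduced_wordsD(1)[OF assms] by (auto simp: reduced_words_def)
qed

lemma reduced_words_replace_factor:
  assumes "p @ u @ q \<in> reduced_words gen n \<pi>" "set v \<subseteq> {1..n}"
    "word_prod gen v = word_prod gen u" "length v \<le> length u"
  shows "p @ v @ q \<in> reduced_words gen n \<pi>"
proof (rule reduced_words_replace[OF assms(1)])
  show "set (p @ v @ q) \<subseteq> {1..n}" using reduced_wordsD(1)[OF assms(1)] assms(2) by auto
  show "word_prod gen (p @ v @ q) = \<pi>" using reduced_wordsD(2)[OF assms(1)] assms(3) by simp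
qed (use assms in auto)

lemma reduced_words_no_square:
  assumes "gen i \<circ> gen i = id" shows "p @ i # i # q \<notin> reduced_words gen n \<pi>"
proof
  assume *: "p @ i # i # q \<in> reduced_words gen n \<pi>"
  have "word_prod gen (p @ q) = \<pi>"
    using reduced_wordsD(2)[OF *] assms by (simp add: fun_eq_iff)
  moreover have "set (p @ q) \<subseteq> {1..n}" using reduced_wordsD(1)[OF *] by auto
  ultimately show False using reduced_wordsD(3)[OF *, of "p @ q"] by auto
qed

lemma finite_reduced_words: "finite (reduced_words gen n \<pi>)"
proof (cases "reduced_words gen n \<pi> = {}")
  case False
  then obtain w where w: "w \<in> reduced_words gen n \<pi>" by auto
  have "reduced_words gen n \<pi> \<subseteq> {v. set v \<subseteq> {1..n} \<and> length v \<le> length w}"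
    using reduced_wordsD(1) reduced_words_same_length[OF w] by fastforce
  then show ?thesis using finite_words_bounded finite_subset by blast
qed simp

section \<open>Sums over reduced words and their coproduct\<close>

lemma perm_elem_in_Wsp:
  fixes gen :: "nat \<Rightarrow> 'b \<Rightarrow> 'b"
  shows "perm_elem gen n \<pi> \<in> (Wsp :: (wbasis \<Rightarrow> 'a::field_char_0) set)"
proof (rule WspI)
  fix w n' assume "perm_elem gen n \<pi> (w, n') \<noteq> (0::'a)"
  then have w: "w \<in> reduced_words gen n \<pi>" and n: "n' = n"
    by (auto simp: perm_elem_def split: if_splits)
  show "set w \<subseteq> {1..n'} \<and> length w \<le> Max (length ` reduced_words gen n \<pi>) \<and> n' \<le> n"
    using reduced_wordsD(1)[OF w] w n finite_reduced_words[of gen n \<pi>] by auto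
qed

text \<open>All reduced words of one element have the same length, so the basis elements are
  homogeneous.\<close>

lemma hcomp_perm_elem:
  fixes gen :: "nat \<Rightarrow> 'b \<Rightarrow> 'b"
  shows "hcomp d (perm_elem gen n \<pi> :: wbasis \<Rightarrow> 'a::field_char_0) \<in> {perm_elem gen n \<pi>, \<lambda>_. 0}"
proof (cases "\<exists>w\<in>reduced_words gen n \<pi>. length w = d")
  case True
  then have "length w = d" if "w \<in> reduced_words gen n \<pi>" for w
    using reduced_words_same_length[OF that] by auto
  then have "hcomp d (perm_elem gen n \<pi>) = (perm_elem gen n \<pi> :: wbasis \<Rightarrow> 'a)"
    by (intro ext) (simp add: hcomp_def perm_elem_def)
  then show ?thesis by simp
next
  case False
  then have "hcomp d (perm_elem gen n \<pi>) = (\<lambda>_. 0 :: 'a)"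
    by (intro ext) (auto simp: hcomp_def perm_elem_def)
  then show ?thesis by simp
qed

lemma sum_fun_apply: "(\<Sum>i\<in>I. F i) x = (\<Sum>i\<in>I. F i x)"
  by (induction I rule: infinite_finite_induct) auto

text \<open>A word is a reduced word of its own product only, so at each point at most one summand
  is nonzero.\<close>

lemma sum_perm_elem:
  fixes n :: nat
  assumes "finite L"
    and L: "\<And>w. w \<in> L \<Longrightarrow> w \<in> reduced_words gen n (word_prod gen w)"
      "\<And>w v. w \<in> L \<Longrightarrow> v \<in> reduced_words gen n (word_prod gen w) \<Longrightarrow> v \<in> L"
  shows "(\<lambda>x. if snd x = n \<and> fst x \<in> L then 1 else (0::'a::field_char_0)) =
    (\<Sum>\<pi>\<in>word_prod gen ` L. perm_elem gen n \<pi>)"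
proof
  fix x :: wbasis
  have "(\<Sum>\<pi>\<in>word_prod gen ` L. perm_elem gen n \<pi>) x =
    (\<Sum>\<pi>\<in>word_prod gen ` L. if \<pi> = word_prod gen (fst x) then (if snd x = n \<and> fst x \<in> L then 1 else 0) else (0::'a))"
    unfolding sum_fun_apply
  proof (intro sum.cong refl)
    fix \<pi> assume "\<pi> \<in> word_prod gen ` L"
    then obtain w where w: "w \<in> L" "\<pi> = word_prod gen w" by auto
    have iff: "fst x \<in> reduced_words gen n \<pi> \<longleftrightarrow> \<pi> = word_prod gen (fst x) \<and> fst x \<in> L"
      using L(1)[of "fst x"] L(2)[OF w(1), of "fst x"] w(2) reduced_wordsD(2)[of "fst x" gen n \<pi>] by metis
    show "perm_elem gen n \<pi> x = (if \<pi> = word_prod gen (fst x) then (if snd x = n \<and> fst x \<in> L then 1 else 0) else (0::'a))"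
      using iff by (auto simp: perm_elem_def)
  qed
  also have "\<dots> = (if snd x = n \<and> fst x \<in> L then 1 else 0)"
    using assms(1) by (auto simp: sum.delta)
  finally show "(if snd x = n \<and> fst x \<in> L then 1 else (0::'a)) = (\<Sum>\<pi>\<in>word_prod gen ` L. perm_elem gen n \<pi>) x" ..
qed

text \<open>The index set consists of the length-additive factorizations of \<pi>. It is written as
  an image so that a pair reached by several cuts counts once. Given one such cut
  \<open>u @ v\<close>, replacing each half by any reduced word of the same element keeps product
  and length, so it gives another reduced word of \<pi>.\<close>

lemma Wcop_perm_elem:
  fixes gen :: "nat \<Rightarrow> 'b \<Rightarrow> 'b"
  shows "Wcop (perm_elem gen n \<pi> :: wbasis \<Rightarrow> 'a::field_char_0) = (\<Sum>(\<alpha>, \<beta>)\<in>(\<lambda>(p, q). (word_prod gen p, word_prod gen q)) `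
      {(p, q). p @ q \<in> reduced_words gen n \<pi>}.
     tens (perm_elem gen n \<alpha>) (perm_elem gen n \<beta>))" (is "_ = (\<Sum>(\<alpha>, \<beta>)\<in>?I. _ \<alpha> \<beta>)")
proof
  fix x :: "wbasis \<times> wbasis"
  obtain p N q N' where x: "x = ((p, N), (q, N'))" by (metis surj_pair)
  let ?c = "N = n \<and> N' = n \<and> p @ q \<in> reduced_words gen n \<pi>"
  have fin: "finite (supp (perm_elem gen n \<pi> :: wbasis \<Rightarrow> 'a))"
    using perm_elem_in_Wsp[of gen n \<pi>, where 'a='a] by (simp add: Wsp_def)
  have "{(p, q). p @ q \<in> reduced_words gen n \<pi>} \<subseteq>
      (\<Union>w\<in>reduced_words gen n \<pi>. (\<lambda>i. (take i w, drop i w)) ` {..length w})"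
  proof clarify
    fix u v assume "u @ v \<in> reduced_words gen n \<pi>"
    then show "(u, v) \<in> (\<Union>w\<in>reduced_words gen n \<pi>. (\<lambda>i. (take i w, drop i w)) ` {..length w})"
      by (intro UN_I[of "u @ v"] image_eqI[of _ _ "length u"]) auto
  qed
  then have "finite {(p, q). p @ q \<in> reduced_words gen n \<pi>}"
    by (rule finite_subset) (auto intro: finite_reduced_words)
  then have finI: "finite ?I" by simp
  have "(\<Sum>(\<alpha>, \<beta>)\<in>?I. tens (perm_elem gen n \<alpha>) (perm_elem gen n \<beta>)) x =
    (\<Sum>k\<in>?I. if k = (word_prod gen p, word_prod gen q) then (if ?c then 1 else 0) else (0::'a))"
    unfolding sum_fun_apply
  proof (intro sum.cong refl)
    fix k assume "k \<in> ?I"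
    then obtain u v where uv: "u @ v \<in> reduced_words gen n \<pi>" and k: "k = (word_prod gen u, word_prod gen v)"
      by auto
    have u: "u \<in> reduced_words gen n (word_prod gen u)" and v: "v \<in> reduced_words gen n (word_prod gen v)"
      using reduced_words_factor[of "[]" u v] reduced_words_factor[of u v "[]"] uv by auto
    have 1: "p \<in> reduced_words gen n (word_prod gen p)" "q \<in> reduced_words gen n (word_prod gen q)"
      if "p @ q \<in> reduced_words gen n \<pi>"
      using reduced_words_factor[of "[]" p q] reduced_words_factor[of p q "[]"] that by auto
    have 2: "p @ q \<in> reduced_words gen n \<pi>"
      if p: "p \<in> reduced_words gen n (word_prod gen u)" and q: "q \<in> reduced_words gen n (word_prod gen v)"
    proof (rule reduced_words_replace[OF uv])
      show "set (p @ q) \<subseteq> {1..n}" using reduced_wordsD(1)[OF p] reduced_wordsD(1)[OF q] by simp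
      show "word_prod gen (p @ q) = \<pi>"
        using reduced_wordsD(2)[OF p] reduced_wordsD(2)[OF q] reduced_wordsD(2)[OF uv] by simp
      show "length (p @ q) \<le> length (u @ v)"
        using reduced_words_same_length[OF p u] reduced_words_same_length[OF q v] by simp
    qed
    have iff: "p \<in> reduced_words gen n (word_prod gen u) \<and> q \<in> reduced_words gen n (word_prod gen v)
       \<longleftrightarrow> word_prod gen u = word_prod gen p \<and> word_prod gen v = word_prod gen q \<and> p @ q \<in> reduced_words gen n \<pi>"
      using 1 2 reduced_wordsD(2)[of p gen n "word_prod gen u"] reduced_wordsD(2)[of q gen n "word_prod gen v"]
      by metis
    show "(case k of (\<alpha>, \<beta>) \<Rightarrow> tens (perm_elem gen n \<alpha>) (perm_elem gen n \<beta>)) x =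
       (if k = (word_prod gen p, word_prod gen q) then (if ?c then 1 else 0) else (0::'a))"
      using iff by (auto simp: k x tens_def perm_elem_def)
  qed
  also have "\<dots> = (if ?c then 1 else 0)"
    using finI by (auto simp: sum.delta)
  also have "\<dots> = Wcop (perm_elem gen n \<pi>) x"
    unfolding x Wcop_eq[OF fin] by (auto simp: perm_elem_def)
  finally show "Wcop (perm_elem gen n \<pi>) x =
    (\<Sum>(\<alpha>, \<beta>)\<in>?I. tens (perm_elem gen n \<alpha>) (perm_elem gen n \<beta> :: wbasis \<Rightarrow> 'a)) x" ..
qed

lemma Wcop_lincomb:
  assumes "f \<in> Wsp" "g \<in> Wsp"
  shows "Wcop (\<lambda>x. c * f x + g x) = (\<lambda>x. c * Wcop f x + Wcop g x)"
proof
  fix x :: "wbasis \<times> wbasis"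
  obtain p N q N' where x: "x = ((p, N), (q, N'))" by (metis surj_pair)
  show "Wcop (\<lambda>x. c * f x + g x) x = c * Wcop f x + Wcop g x"
    using assms Wsp_lincomb[OF assms, of c] unfolding x by (auto simp: Wcop_eq Wsp_def)
qed

text \<open>Two facts carry this for any generating family: factors of reduced words are reduced,
  and the reduced words of one element share their length.\<close>

lemma graded_subcoalgebra_perm_elem:
  fixes gen :: "nat \<Rightarrow> 'b \<Rightarrow> 'b" and G :: "nat \<Rightarrow> ('b \<Rightarrow> 'b) set" and I :: "nat set"
  defines "M \<equiv> kspan {perm_elem gen n \<pi> | n \<pi>. n \<in> I \<and> \<pi> \<in> G n} :: (wbasis \<Rightarrow> 'a::field_char_0) set"
  assumes G: "\<And>n w. n \<in> I \<Longrightarrow> set w \<subseteq> {1..n} \<Longrightarrow> word_prod gen w \<in> G n"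
  shows "graded_subcoalgebra M"
proof -
  let ?S = "{perm_elem gen n \<pi> | n \<pi>. n \<in> I \<and> \<pi> \<in> G n} :: (wbasis \<Rightarrow> 'a::field_char_0) set"
  have S: "?S \<subseteq> Wsp" by (auto simp: perm_elem_in_Wsp)
  have M: "M \<subseteq> Wsp" unfolding M_def using S by (rule kspan_subset_Wsp)
  have "hcomp d f \<in> M" if "f \<in> M" for f d
    using that unfolding M_def
  proof (induction rule: kspan_induct)
    case zero
    then show ?case using kspan_zero[of ?S] by (simp add: hcomp_def zero_fun_def)
  next
    case (step c g h)
    have "hcomp d g \<in> kspan ?S"
      using step(1) hcomp_perm_elem[where 'a='a] kspan_zero[of ?S] by (fastforce simp: zero_fun_def intro: kspan_base)
    then have "(\<lambda>x. c * hcomp d g x + hcomp d h x) \<in> kspan ?S"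
      using step by (intro kspan_lincomb)
    also have "(\<lambda>x. c * hcomp d g x + hcomp d h x) = hcomp d (\<lambda>x. c * g x + h x)"
      by (auto simp: hcomp_def)
    finally show ?case .
  qed
  moreover have "Wcop f \<in> tensor_sp M M" if "f \<in> M" for f
    using that unfolding M_def
  proof (induction rule: kspan_induct)
    case zero
    then show ?case using kspan_zero by (simp add: Wcop_def supp_def tensor_sp_def zero_fun_def)
  next
    case (step c g h)
    from step(1) obtain n \<pi> where g: "g = perm_elem gen n \<pi>" and n: "n \<in> I" by auto
    have "Wcop g \<in> tensor_sp (kspan ?S) (kspan ?S)"
      unfolding g Wcop_perm_elem tensor_sp_def
    proof (rule kspan_sum)
      fix k assume "k \<in> (\<lambda>(p, q). (word_prod gen p, word_prod gen q)) ` {(p, q). p @ q \<in> reduced_words gen n \<pi>}"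
      then obtain u v where "u @ v \<in> reduced_words gen n \<pi>" and k: "k = (word_prod gen u, word_prod gen v)"
        by auto
      from this(1) have "set u \<subseteq> {1..n}" "set v \<subseteq> {1..n}" using reduced_wordsD(1) by fastforce+
      then have "word_prod gen u \<in> G n" "word_prod gen v \<in> G n" using G[OF n] by auto
      then have "perm_elem gen n (word_prod gen u) \<in> kspan ?S" "perm_elem gen n (word_prod gen v) \<in> kspan ?S"
        using n by (auto intro!: kspan_base)
      then show "(case k of (\<alpha>, \<beta>) \<Rightarrow> tens (perm_elem gen n \<alpha>) (perm_elem gen n \<beta>))
          \<in> kspan {tens f g |f g. f \<in> kspan ?S \<and> g \<in> kspan ?S}"
        unfolding k prod.case by (intro kspan_base) blast
    qed
    then show ?case
      using step M S unfolding tensor_sp_def M_def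
      by (subst Wcop_lincomb) (auto intro!: kspan_lincomb)
  qed
  moreover have "length (fst p) + length (fst q) = d" if "f \<in> M" "homog d f" "Wcop f (p, q) \<noteq> 0" for f d p q
  proof -
    obtain u n v n' where pq: "p = (u, n)" "q = (v, n')" by (metis surj_pair)
    have "finite (supp f)" using that(1) M by (auto simp: Wsp_def)
    then have "f (u @ v, n) \<noteq> 0" using that(3) unfolding pq by (auto simp: Wcop_eq split: if_splits)
    then show ?thesis using that(2) pq by (auto simp: homog_iff)
  qed
  moreover have "kspan M = M" unfolding M_def by (rule kspan_kspan)
  ultimately show ?thesis using M unfolding graded_subcoalgebra_def graded_subspace_def by blast
qed

section \<open>Tits' word property from the exchange condition\<close>

text \<open>Grown at the right end, so that the first argument is the last letter:
  \<open>alternating 2 i j = [j, i]\<close> and \<open>alternating 3 i j = [i, j, i]\<close>. This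
  fits right descents, which are read off at that end.\<close>

fun alternating :: "nat \<Rightarrow> 'b \<Rightarrow> 'b \<Rightarrow> 'b list" where
  "alternating 0 i j = []"
| "alternating (Suc m) i j = alternating m j i @ [i]"

lemma length_alternating [simp]: "length (alternating m i j) = m"
  by (induction m arbitrary: i j) auto

lemma set_alternating: "set (alternating m i j) \<subseteq> {i, j}"
  by (induction m arbitrary: i j) auto

definition braid_closed :: "nat \<Rightarrow> (nat \<Rightarrow> nat \<Rightarrow> nat) \<Rightarrow> nat list set \<Rightarrow> bool" where
  "braid_closed n m L \<longleftrightarrow> (\<forall>p q i j. i \<in> {1..n} \<longrightarrow> j \<in> {1..n} \<longrightarrow> i \<noteq> j \<longrightarrow>
     p @ alternating (m i j) i j @ q \<in> L \<longrightarrow> p @ alternating (m i j) j i @ q \<in> L)"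

text \<open>\<open>D \<pi> i\<close> stands for \<open>i\<close> being a right descent of \<open>\<pi>\<close>.\<close>

fun descends_rev :: "(('b \<Rightarrow> 'b) \<Rightarrow> nat \<Rightarrow> bool) \<Rightarrow> (nat \<Rightarrow> 'b \<Rightarrow> 'b) \<Rightarrow> ('b \<Rightarrow> 'b) \<Rightarrow> nat list \<Rightarrow> bool" where
  "descends_rev D gen \<pi> [] \<longleftrightarrow> True"
| "descends_rev D gen \<pi> (i # w) \<longleftrightarrow> D \<pi> i \<and> descends_rev D gen (\<pi> \<circ> gen i) w"

text \<open>The letters of \<open>w\<close> can be stripped from the right end of \<pi> one after
  the other, each being a descent at its turn.\<close>

definition descends where "descends D gen \<pi> w \<longleftrightarrow> descends_rev D gen \<pi> (rev w)"

lemma descends_simps [simp]: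
  "descends D gen \<pi> []"
  "descends D gen \<pi> (w @ [i]) \<longleftrightarrow> D \<pi> i \<and> descends D gen (\<pi> \<circ> gen i) w"
  by (auto simp: descends_def)

text \<open>The part of Coxeter theory that the word property uses, with \<open>m\<close> as Coxeter
  matrix. The axiom \<open>dihedral\<close> stands in for parabolic factorization: an element with
  descents \<open>i\<close> and \<open>j\<close> ends in the longest word of the rank two subgroup
  they generate. In the signed groups it becomes a comparison of a few integers.\<close>

locale exchange_system =
  fixes gen :: "nat \<Rightarrow> 'b \<Rightarrow> 'b" and n :: nat and m :: "nat \<Rightarrow> nat \<Rightarrow> nat"
    and D :: "('b \<Rightarrow> 'b) \<Rightarrow> nat \<Rightarrow> bool"
  assumes involution: "i \<in> {1..n} \<Longrightarrow> gen i \<circ> gen i = id"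
    and exchange: "set w \<subseteq> {1..n} \<Longrightarrow> i \<in> {1..n} \<Longrightarrow> D (word_prod gen w) i \<Longrightarrow>
      \<exists>p j q. w = p @ j # q \<and> word_prod gen w \<circ> gen i = word_prod gen (p @ q)"
    and descent_or_ascent: "set w \<subseteq> {1..n} \<Longrightarrow> i \<in> {1..n} \<Longrightarrow>
      D (word_prod gen w \<circ> gen i) i \<longleftrightarrow> \<not> D (word_prod gen w) i"
    and m_pos: "i \<in> {1..n} \<Longrightarrow> j \<in> {1..n} \<Longrightarrow> i \<noteq> j \<Longrightarrow> 0 < m i j"
    and braid_relation: "i \<in> {1..n} \<Longrightarrow> j \<in> {1..n} \<Longrightarrow> i \<noteq> j \<Longrightarrow>
      word_prod gen (alternating (m i j) i j) = word_prod gen (alternating (m i j) j i)"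
    and dihedral: "set w \<subseteq> {1..n} \<Longrightarrow> i \<in> {1..n} \<Longrightarrow> j \<in> {1..n} \<Longrightarrow> i \<noteq> j \<Longrightarrow>
      D (word_prod gen w) i \<Longrightarrow> D (word_prod gen w) j \<Longrightarrow>
      descends D gen (word_prod gen w) (alternating (m i j) i j)"
begin

section \<open>Descents and length, and the word property\<close>

definition reduced :: "nat list \<Rightarrow> bool" where
  "reduced w \<longleftrightarrow> w \<in> reduced_words gen n (word_prod gen w)"

lemma reduced_snoc_iff:
  assumes "set w \<subseteq> {1..n}" "i \<in> {1..n}"
  shows "reduced (w @ [i]) \<longleftrightarrow> reduced w \<and> \<not> D (word_prod gen w) i"
proof
  assume r: "reduced (w @ [i])"
  then have w: "reduced w" using reduced_words_factor[of "[]" w "[i]"] by (auto simp: reduced_def)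
  have "\<not> D (word_prod gen w) i"
  proof
    assume "D (word_prod gen w) i"
    from exchange[OF assms this] obtain p j q where
      pq: "w = p @ j # q" "word_prod gen w \<circ> gen i = word_prod gen (p @ q)" by blast
    have "length (w @ [i]) \<le> length (p @ q)"
      using r pq assms unfolding reduced_def
      by (intro reduced_wordsD(3)[of "w @ [i]" gen n "word_prod gen (w @ [i])"]) (auto simp: comp_assoc)
    then show False using pq by auto
  qed
  then show "reduced w \<and> \<not> D (word_prod gen w) i" using w by simp
next
  \<comment> \<open>Exchange is applied to a reduced word of \<open>w @ [i]\<close>, which has
    descent \<open>i\<close>: deleting one of its letters leaves a word for the product of
    \<open>w\<close>, hence that reduced word is longer than \<open>w\<close>.\<close>
  assume a: "reduced w \<and> \<not> D (word_prod gen w) i"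
  have wi: "set (w @ [i]) \<subseteq> {1..n}" using assms by auto
  then obtain v where v: "v \<in> reduced_words gen n (word_prod gen (w @ [i]))" by (rule reduced_words_exist)
  note vD = reduced_wordsD[OF v]
  have "D (word_prod gen v) i" using descent_or_ascent[OF assms] a vD(2) by simp
  from exchange[OF vD(1) assms(2) this] obtain p j q where
    pq: "v = p @ j # q" "word_prod gen v \<circ> gen i = word_prod gen (p @ q)" by blast
  have "word_prod gen v \<circ> gen i = word_prod gen w"
    using vD(2) involution[OF assms(2)] by (simp add: comp_assoc)
  then have "length w \<le> length (p @ q)"
    using a pq vD(1) unfolding reduced_def by (intro reduced_wordsD(3)[of w gen n "word_prod gen w"]) auto
  then have "length (w @ [i]) \<le> length v" using pq by simp
  then show "reduced (w @ [i])" unfolding reduced_def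
    by (intro reduced_words_replace[OF v]) (use wi in auto)
qed

lemma descent_reduced_word:
  assumes "set w \<subseteq> {1..n}" "i \<in> {1..n}" "D (word_prod gen w) i"
  obtains v where "set v \<subseteq> {1..n}" "reduced (v @ [i])" "word_prod gen (v @ [i]) = word_prod gen w"
proof -
  have wi: "set (w @ [i]) \<subseteq> {1..n}" using assms by auto
  then obtain v where v: "v \<in> reduced_words gen n (word_prod gen (w @ [i]))" by (rule reduced_words_exist)
  note vD = reduced_wordsD[OF v]
  have "reduced v" using v vD(2) by (simp add: reduced_def)
  moreover have "\<not> D (word_prod gen v) i"
    using vD(2) descent_or_ascent[OF assms(1,2)] assms(3) by simp
  ultimately have "reduced (v @ [i])" using reduced_snoc_iff[OF vD(1) assms(2)] by simp
  moreover have "word_prod gen (v @ [i]) = word_prod gen w"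
    using vD(2) involution[OF assms(2)] by (simp add: comp_assoc)
  ultimately show ?thesis using that vD(1) by blast
qed

text \<open>After a descent has been stripped it is no longer a descent, so putting the letter back
  lengthens a reduced word by one and keeps it reduced.\<close>

lemma descends_reduced_word:
  assumes "set w \<subseteq> {1..n}" "set u \<subseteq> {1..n}" "descends D gen (word_prod gen w) u"
  shows "\<exists>v. set v \<subseteq> {1..n} \<and> reduced (v @ u) \<and> word_prod gen (v @ u) = word_prod gen w"
  using assms
proof (induction u arbitrary: w rule: rev_induct)
  case Nil
  from Nil(1) obtain v where v: "v \<in> reduced_words gen n (word_prod gen w)" by (rule reduced_words_exist)
  then show ?case using reduced_wordsD[OF v] by (intro exI[of _ v]) (simp add: reduced_def)
next
  case (snoc i u)
  have i: "i \<in> {1..n}" "D (word_prod gen w) i" and d: "descends D gen (word_prod gen (w @ [i])) u"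
    using snoc.prems by auto
  have "\<exists>v. set v \<subseteq> {1..n} \<and> reduced (v @ u) \<and> word_prod gen (v @ u) = word_prod gen (w @ [i])"
    by (rule snoc.IH[OF _ _ d]) (use snoc.prems in auto)
  then obtain v where v: "set v \<subseteq> {1..n}" "reduced (v @ u)" "word_prod gen (v @ u) = word_prod gen (w @ [i])"
    by blast
  have "\<not> D (word_prod gen (v @ u)) i"
    using v(3) descent_or_ascent[OF snoc.prems(1) i(1)] i(2) by simp
  then have "reduced ((v @ u) @ [i])"
    using v(1,2) snoc.prems(2) i(1) by (subst reduced_snoc_iff) auto
  moreover have "word_prod gen ((v @ u) @ [i]) = word_prod gen w"
    unfolding word_prod_append[of gen "v @ u"] v(3) using involution[OF i(1)] by (simp add: comp_assoc)
  ultimately show ?case using v(1) by (intro exI[of _ v]) (simp add: comp_assoc)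
qed

lemma braid_closed_snoc: "braid_closed n m L \<Longrightarrow> braid_closed n m {p. p @ q \<in> L}"
  unfolding braid_closed_def by auto

text \<open>Induction on length, with \<open>L\<close> varying so that it can be replaced by the
  prefixes of words with a fixed ending. If the last letters \<open>s\<close> and \<open>t\<close>
  differ, both are descents of the common product, so \<open>dihedral\<close> provides reduced words
  \<open>x @ ?a\<close> and \<open>x @ ?b\<close> that differ by one braid move. The induction
  hypothesis leads from \<open>u\<close> to the one ending in \<open>s\<close>, and from the one
  ending in \<open>t\<close> to \<open>v\<close>.\<close>

lemma matsumoto:
  assumes "braid_closed n m L" "u \<in> L" "reduced u" "reduced v" "word_prod gen u = word_prod gen v"
  shows "v \<in> L"
  using assms
proof (induction "length u" arbitrary: u v L)
  case 0
  have "length u = length v"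
    using 0 reduced_words_same_length[of u gen n _ v] unfolding reduced_def by metis
  then show ?case using 0 by simp
next
  case (Suc l)
  have len: "length u = length v"
    using Suc.prems reduced_words_same_length[of u gen n _ v] unfolding reduced_def by metis
  obtain u' s where u: "u = u' @ [s]" using Suc.hyps(2) by (cases u rule: rev_cases) auto
  obtain v' t where v: "v = v' @ [t]" using Suc.hyps(2) len by (cases v rule: rev_cases) auto
  have su: "set u' \<subseteq> {1..n}" "s \<in> {1..n}" and sv: "set v' \<subseteq> {1..n}" "t \<in> {1..n}"
    using reduced_wordsD(1)[OF Suc.prems(3)[unfolded reduced_def]]
      reduced_wordsD(1)[OF Suc.prems(4)[unfolded reduced_def]] u v by auto
  have ru: "reduced u'" "\<not> D (word_prod gen u') s" and rv: "reduced v'" "\<not> D (word_prod gen v') t"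
    using Suc.prems u v reduced_snoc_iff su sv by auto
  have l: "length u' = l" "length v' = l" using Suc.hyps(2) len u v by auto
  have cancel: "word_prod gen x = word_prod gen y"
    if "word_prod gen (x @ [i]) = word_prod gen (y @ [i])" "i \<in> {1..n}" for x y i
    using arg_cong[OF that(1), of "\<lambda>f. f \<circ> gen i"] involution[OF that(2)] by (simp add: comp_assoc)
  have IH: "y \<in> L'" if "braid_closed n m L'" "x \<in> L'" "reduced x" "reduced y" "length x = l"
     "word_prod gen (x @ [i]) = word_prod gen (y @ [i])" "i \<in> {1..n}" for x y L' i
    using Suc.hyps(1)[of x L' y] that cancel[of x i y] by blast
  show ?case
  proof (cases "s = t")
    case True
    have "v' \<in> {p. p @ [s] \<in> L}"
      using Suc.prems u v True su(2)
      by (intro IH[OF braid_closed_snoc[OF Suc.prems(1)] _ ru(1) rv(1) l(1)]) auto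
    then show ?thesis using v True by simp
  next
    case False
    let ?\<pi> = "word_prod gen u"
    have u1: "set u \<subseteq> {1..n}" using u su by auto
    have D: "D ?\<pi> s" "D ?\<pi> t"
      using descent_or_ascent[OF su] ru descent_or_ascent[OF sv] rv Suc.prems(5) u v by auto
    \<comment> \<open>Positivity of \<open>m s t\<close> lets the last letter be split off:
      \<open>?a\<close> ends in \<open>s\<close> and \<open>?b\<close> in \<open>t\<close>, and
      their prefixes of length \<open>k\<close> have the form the induction hypothesis
      needs.\<close>
    obtain k where k: "m s t = Suc k" using m_pos[OF su(2) sv(2) False] gr0_implies_Suc by blast
    let ?a = "alternating (m s t) s t" and ?b = "alternating (m s t) t s"
    have sa: "set ?a \<subseteq> {1..n}" "set ?b \<subseteq> {1..n}"
      using set_alternating[of "m s t" s t] set_alternating[of "m s t" t s] su(2) sv(2) by blast+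
    obtain x where x: "set x \<subseteq> {1..n}" "reduced (x @ ?a)" "word_prod gen (x @ ?a) = ?\<pi>"
      using descends_reduced_word[OF u1 sa(1) dihedral[OF u1 su(2) sv(2) False D]] by blast
    have eq: "word_prod gen (x @ ?b) = word_prod gen (x @ ?a)"
      using braid_relation[OF su(2) sv(2) False] by simp
    have "reduced (x @ ?b)" unfolding reduced_def eq
      by (rule reduced_words_replace[of "x @ ?a"]) (use x sa eq in \<open>auto simp: reduced_def\<close>)
    then have rb: "reduced (x @ alternating k s t)"
      using reduced_words_factor[of "[]" "x @ alternating k s t" "[t]"] by (simp add: k reduced_def)
    have ra: "reduced (x @ alternating k t s)"
      using reduced_words_factor[of "[]" "x @ alternating k t s" "[s]"] x(2) by (simp add: k reduced_def)
    have len_x: "length (x @ alternating k s t) = l"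
    proof -
      have "length (x @ ?a) = length u"
        using x(2,3) Suc.prems(3) reduced_words_same_length[of "x @ ?a" gen n ?\<pi> u] unfolding reduced_def by metis
      then show ?thesis using k Suc.hyps(2) by simp
    qed
    have "x @ alternating k t s \<in> {p. p @ [s] \<in> L}"
    proof (rule IH[OF braid_closed_snoc[OF Suc.prems(1)] _ ru(1) ra l(1) _ su(2)])
      show "word_prod gen (u' @ [s]) = word_prod gen ((x @ alternating k t s) @ [s])"
        using x(3) u k by simp
    qed (use Suc.prems(2) u in simp)
    then have "x @ ?a @ [] \<in> L" by (simp add: k)
    then have "x @ ?b @ [] \<in> L" using Suc.prems(1) su(2) sv(2) False unfolding braid_closed_def by blast
    then have "x @ alternating k s t \<in> {p. p @ [t] \<in> L}" by (simp add: k)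
    then have "v' \<in> {p. p @ [t] \<in> L}"
    proof (rule IH[OF braid_closed_snoc[OF Suc.prems(1)] _ rb rv(1) len_x _ sv(2)])
      show "word_prod gen ((x @ alternating k s t) @ [t]) = word_prod gen (v' @ [t])"
        using eq x(3) Suc.prems(5) k v by (simp add: comp_assoc)
    qed
    then show ?thesis using v by simp
  qed
qed

text \<open>A non-reduced word in a braid-closed set could be braided, up to its first descent,
  into a word with a repeated letter.\<close>

lemma braid_closed_reduced:
  assumes L: "braid_closed n m L" "\<And>p i q. p @ i # i # q \<notin> L"
    and w: "p @ q \<in> L" "set p \<subseteq> {1..n}"
  shows "reduced p"
  using w
proof (induction p arbitrary: q rule: rev_induct)
  case Nil
  then show ?case by (simp add: reduced_def reduced_words_def)
next
  case (snoc i p)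
  have p: "set p \<subseteq> {1..n}" "i \<in> {1..n}" using snoc.prems by auto
  have rp: "reduced p" using snoc.IH[of "i # q"] snoc.prems by simp
  have "\<not> D (word_prod gen p) i"
  proof
    assume "D (word_prod gen p) i"
    from descent_reduced_word[OF p this] obtain v where
      v: "reduced (v @ [i])" "word_prod gen (v @ [i]) = word_prod gen p" by blast
    have "v @ [i] \<in> {p. p @ i # q \<in> L}"
      by (rule matsumoto[OF braid_closed_snoc[OF L(1)] _ rp v(1)]) (use snoc.prems v(2) in auto)
    then show False using L(2)[of v i q] by simp
  qed
  then show ?case using reduced_snoc_iff[OF p] rp by simp
qed

lemma braid_closed_indicator:
  assumes L: "braid_closed n m L" "\<And>p i q. p @ i # i # q \<notin> L"
    and "finite L" "\<And>w. w \<in> L \<Longrightarrow> set w \<subseteq> {1..n}"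
  shows "(\<lambda>x. if snd x = n \<and> fst x \<in> L then 1 else (0::'a::field_char_0)) =
    (\<Sum>\<pi>\<in>word_prod gen ` L. perm_elem gen n \<pi>)"
proof (rule sum_perm_elem)
  show red: "w \<in> reduced_words gen n (word_prod gen w)" if "w \<in> L" for w
    using braid_closed_reduced[OF L, of w "[]"] assms(4) that by (simp add: reduced_def)
  show "v \<in> L" if "w \<in> L" "v \<in> reduced_words gen n (word_prod gen w)" for w v
  proof (rule matsumoto[OF L(1) that(1)])
    show eq: "word_prod gen w = word_prod gen v" using reduced_wordsD(2)[OF that(2)] by simp
    show "reduced w" "reduced v" using red[OF that(1)] that(2) eq by (simp_all add: reduced_def)
  qed
qed (rule assms)

end


section \<open>The groups of types B and D\<close>

text \<open>The reflections of the signed permutation groups; for \<open>b = - a\<close> this is a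
  sign change, so one formula covers all generators.\<close>

definition signed_swap :: "int \<Rightarrow> int \<Rightarrow> int \<Rightarrow> int" where
  "signed_swap a b k = (if k = a then b else if k = b then a
     else if k = - a then - b else if k = - b then - a else k)"

definition odd_map :: "(int \<Rightarrow> int) \<Rightarrow> bool" where
  "odd_map \<pi> \<longleftrightarrow> (\<forall>k. \<pi> (- k) = - \<pi> k)"

lemma signed_swap_involution:
  "a \<noteq> 0 \<Longrightarrow> b \<noteq> 0 \<Longrightarrow> signed_swap a b \<circ> signed_swap a b = id"
  by (auto simp: signed_swap_def fun_eq_iff)

lemma signed_swap_odd: "a \<noteq> 0 \<Longrightarrow> b \<noteq> 0 \<Longrightarrow> odd_map (signed_swap a b)"
  by (auto simp: signed_swap_def odd_map_def)

lemma signed_swap_uminus: "a \<noteq> 0 \<Longrightarrow> b \<noteq> 0 \<Longrightarrow> signed_swap (- b) (- a) = signed_swap a b"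
  by (auto simp: signed_swap_def fun_eq_iff)

text \<open>Conjugation turns the reflection in a root into the reflection in the image of that
  root.\<close>

lemma signed_swap_conjugate:
  assumes "inj \<pi>" "odd_map \<pi>"
  shows "\<pi> \<circ> signed_swap a b = signed_swap (\<pi> a) (\<pi> b) \<circ> \<pi>"
proof
  fix k
  have [simp]: "\<pi> x = \<pi> y \<longleftrightarrow> x = y" for x y using assms(1) by (auto dest: injD)
  have [simp]: "- \<pi> x = \<pi> (- x)" for x using assms(2) by (simp add: odd_map_def)
  show "(\<pi> \<circ> signed_swap a b) k = (signed_swap (\<pi> a) (\<pi> b) \<circ> \<pi>) k"
    by (simp add: signed_swap_def)
qed

text \<open>A pair \<open>(x, y)\<close> encodes the root \<open>e_y - e_x\<close>, where
  \<open>e_(-x) = - e_x\<close>; it is positive when \<open>x < y\<close>. The pairs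
  \<open>(x, y)\<close> and \<open>(- y, - x)\<close> are the same root, whence the disjunction in
  \<open>simple_reversal\<close>, which says that a simple reflection makes no positive root
  negative except its own.\<close>

locale signed_reflections =
  fixes gen :: "nat \<Rightarrow> int \<Rightarrow> int" and a b :: "nat \<Rightarrow> int" and n :: nat
    and root :: "int \<Rightarrow> int \<Rightarrow> bool"
  assumes gen_eq: "i \<in> {1..n} \<Longrightarrow> gen i = signed_swap (a i) (b i)"
    and nonzero: "i \<in> {1..n} \<Longrightarrow> a i \<noteq> 0 \<and> b i \<noteq> 0"
    and positive: "i \<in> {1..n} \<Longrightarrow> a i < b i \<and> root (a i) (b i)"
    and root_invariant: "i \<in> {1..n} \<Longrightarrow> root x y \<Longrightarrow> root (gen i x) (gen i y)"
    and simple_reversal: "i \<in> {1..n} \<Longrightarrow> root x y \<Longrightarrow> x < y \<Longrightarrow> gen i y < gen i x \<Longrightarrow>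
      x = a i \<and> y = b i \<or> x = - b i \<and> y = - a i"
begin

lemma gen_involution: "i \<in> {1..n} \<Longrightarrow> gen i \<circ> gen i = id"
  using gen_eq nonzero signed_swap_involution by simp

lemma gen_inj: "i \<in> {1..n} \<Longrightarrow> inj (gen i)"
  using gen_involution by (metis inj_on_id inj_on_imageI2)

lemma gen_odd: "i \<in> {1..n} \<Longrightarrow> odd_map (gen i)"
  using gen_eq nonzero signed_swap_odd by simp

lemma word_prod_inj: "set w \<subseteq> {1..n} \<Longrightarrow> inj (word_prod gen w)"
  by (induction w) (auto intro!: inj_compose gen_inj simp del: comp_apply)

lemma word_prod_odd: "set w \<subseteq> {1..n} \<Longrightarrow> odd_map (word_prod gen w)"
  using gen_odd by (induction w) (auto simp: odd_map_def)

lemma word_prod_root: "set w \<subseteq> {1..n} \<Longrightarrow> root x y \<Longrightarrow> root (word_prod gen w x) (word_prod gen w y)"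
  by (induction w) (auto intro: root_invariant)

text \<open>Letters act from the right end. At the letter \<open>j\<close> where the order of the
  pair flips, \<open>simple_reversal\<close> identifies the current image of the pair as the root of
  \<open>j\<close>.\<close>

lemma reversal_step:
  assumes "set w \<subseteq> {1..n}" "root x y" "x < y" "word_prod gen w y < word_prod gen w x"
  shows "\<exists>p j q. w = p @ j # q \<and> (word_prod gen q x = a j \<and> word_prod gen q y = b j \<or>
    word_prod gen q x = - b j \<and> word_prod gen q y = - a j)"
  using assms
proof (induction w)
  case (Cons i w)
  show ?case
  proof (cases "word_prod gen w y < word_prod gen w x")
    case True
    then obtain p j q where "w = p @ j # q" "word_prod gen q x = a j \<and> word_prod gen q y = b j \<or>
      word_prod gen q x = - b j \<and> word_prod gen q y = - a j" using Cons by auto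
    then show ?thesis by (intro exI[of _ "i # p"]) auto
  next
    case False
    have w: "set w \<subseteq> {1..n}" "i \<in> {1..n}" using Cons.prems by auto
    have "word_prod gen w x \<noteq> word_prod gen w y"
      using word_prod_inj[OF w(1)] Cons.prems(3) by (auto dest: injD)
    then have "word_prod gen w x < word_prod gen w y" using False by simp
    then show ?thesis
      using simple_reversal[OF w(2) word_prod_root[OF w(1) Cons.prems(2)]] Cons.prems(4)
      by (intro exI[of _ "[]"]) auto
  qed
qed simp

text \<open>Here \<open>q\<close> carries the root of \<open>i\<close> to the root of
  \<open>j\<close>, so moving \<open>gen i\<close> leftwards past \<open>q\<close> turns it into
  \<open>gen j\<close>, which cancels the letter \<open>j\<close>.\<close>

lemma signed_exchange:
  assumes "set w \<subseteq> {1..n}" "i \<in> {1..n}" "word_prod gen w (b i) < word_prod gen w (a i)"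
  shows "\<exists>p j q. w = p @ j # q \<and> word_prod gen w \<circ> gen i = word_prod gen (p @ q)"
proof -
  obtain p j q where w: "w = p @ j # q" and
    q: "word_prod gen q (a i) = a j \<and> word_prod gen q (b i) = b j \<or>
       word_prod gen q (a i) = - b j \<and> word_prod gen q (b i) = - a j"
    using reversal_step[OF assms(1) _ _ assms(3)] positive[OF assms(2)] by blast
  have j: "j \<in> {1..n}" and sq: "set q \<subseteq> {1..n}" using w assms(1) by auto
  have "word_prod gen q \<circ> gen i = signed_swap (word_prod gen q (a i)) (word_prod gen q (b i)) \<circ> word_prod gen q"
    unfolding gen_eq[OF assms(2)] by (rule signed_swap_conjugate[OF word_prod_inj[OF sq] word_prod_odd[OF sq]])
  \<comment> \<open>In the second alternative the pair is \<open>(- b j, - a j)\<close>, which has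
    the same reflection.\<close>
  also have "\<dots> = gen j \<circ> word_prod gen q"
    using q nonzero[OF j] by (auto simp: gen_eq[OF j] signed_swap_uminus)
  finally have "gen j \<circ> (word_prod gen q \<circ> gen i) = word_prod gen q"
    using gen_involution[OF j] by (simp add: comp_assoc[symmetric])
  then show ?thesis using w by (intro exI[of _ p] exI[of _ j] exI[of _ q]) (simp add: comp_assoc)
qed

text \<open>What remains to be checked is of rank two. Descent at \<open>i\<close> means that \<pi>
  makes the simple root of \<open>i\<close> negative.\<close>

lemma exchange_systemI:
  assumes "\<And>i j. i \<in> {1..n} \<Longrightarrow> j \<in> {1..n} \<Longrightarrow> i \<noteq> j \<Longrightarrow> 0 < m i j"
    and "\<And>i j. i \<in> {1..n} \<Longrightarrow> j \<in> {1..n} \<Longrightarrow> i \<noteq> j \<Longrightarrow>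
      word_prod gen (alternating (m i j) i j) = word_prod gen (alternating (m i j) j i)"
    and "\<And>\<pi> i j. odd_map \<pi> \<Longrightarrow> i \<in> {1..n} \<Longrightarrow> j \<in> {1..n} \<Longrightarrow> i \<noteq> j \<Longrightarrow>
      \<pi> (b i) < \<pi> (a i) \<Longrightarrow> \<pi> (b j) < \<pi> (a j) \<Longrightarrow>
      descends (\<lambda>\<pi> i. \<pi> (b i) < \<pi> (a i)) gen \<pi> (alternating (m i j) i j)"
  shows "exchange_system gen n m (\<lambda>\<pi> i. \<pi> (b i) < \<pi> (a i))"
proof
  fix w i assume w: "set w \<subseteq> {1..n}" and i: "i \<in> {1..n}"
  have "gen i (a i) = b i" "gen i (b i) = a i" by (auto simp: gen_eq[OF i] signed_swap_def)
  moreover have "word_prod gen w (a i) \<noteq> word_prod gen w (b i)"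
    using word_prod_inj[OF w] positive[OF i] by (auto dest: injD)
  ultimately show "((word_prod gen w \<circ> gen i) (b i) < (word_prod gen w \<circ> gen i) (a i)) =
      (\<not> word_prod gen w (b i) < word_prod gen w (a i))"
    by auto
qed (use assms signed_exchange gen_involution word_prod_odd in auto)

end

text \<open>The roots of type B are the pairs of distinct nonzero integers; those of type D exclude
  \<open>(- k, k)\<close>, because \<open>s\<^sub>1\<^sup>D\<close> reverses the order of \<open>- 1 < 1\<close> without being the reflection in it.\<close>

definition aBD :: "nat \<Rightarrow> int" where "aBD i = (if i = 1 then - 1 else int i - 1)"
definition bD :: "nat \<Rightarrow> int" where "bD i = (if i = 1 then 2 else int i)"

lemma sB_signed_swap: "1 \<le> i \<Longrightarrow> sB i = signed_swap (aBD i) (int i)"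
  by (auto simp: sB_def signed_swap_def aBD_def fun_eq_iff)

text \<open>Conjugating the swap of 1 and 2 by the sign change of 1 gives the signed swap of -1 and
  2; this is the origin of \<open>bD 1 = 2\<close>.\<close>

lemma sD_signed_swap: "1 \<le> i \<Longrightarrow> sD i = signed_swap (aBD i) (bD i)"
  by (auto simp: sD_def sB_def signed_swap_def aBD_def bD_def fun_eq_iff)

interpretation B: signed_reflections sB aBD int n "\<lambda>x y. x \<noteq> 0 \<and> y \<noteq> 0" for n
proof (unfold_locales, goal_cases)
  case (1 i)
  then show ?case using sB_signed_swap by simp
next
  case (5 i x y)
  then show ?case
    by (cases "i = 1") (auto simp: sB_signed_swap signed_swap_def aBD_def split: if_splits)
qed (auto simp: sB_signed_swap signed_swap_def aBD_def)

interpretation D: signed_reflections sD aBD bD n "\<lambda>x y. x \<noteq> 0 \<and> y \<noteq> 0 \<and> x \<noteq> y \<and> x \<noteq> - y" for n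
proof (unfold_locales, goal_cases)
  case (1 i)
  then show ?case using sD_signed_swap by simp
next
  case (4 i x y)
  then show ?case
    by (cases "i = 1") (auto simp: sD_signed_swap signed_swap_def aBD_def bD_def split: if_splits)
next
  case (5 i x y)
  then show ?case
    by (cases "i = 1") (auto simp: sD_signed_swap signed_swap_def aBD_def bD_def split: if_splits)
qed (auto simp: aBD_def bD_def)

section \<open>Coxeter matrices and the rank two checks\<close>

definition mA :: "nat \<Rightarrow> nat \<Rightarrow> nat" where
  "mA i j = (if j = Suc i \<or> i = Suc j then 3 else 2)"

definition mB :: "nat \<Rightarrow> nat \<Rightarrow> nat" where
  "mB i j = (if {i, j} = {1, 2} then 4 else mA i j)"

text \<open>The fork of the diagram: node 1 is joined to node 3 and commutes with node 2.\<close>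

definition mD :: "nat \<Rightarrow> nat \<Rightarrow> nat" where
  "mD i j = (if {i, j} = {1, 2} then 2 else if {i, j} = {1, 3} then 3 else mA i j)"

lemma descends_alternating:
  "descends D gen \<pi> (alternating 2 i j) \<longleftrightarrow> D \<pi> i \<and> D (\<pi> \<circ> gen i) j"
  "descends D gen \<pi> (alternating 3 i j) \<longleftrightarrow> D \<pi> i \<and> D (\<pi> \<circ> gen i) j \<and> D (\<pi> \<circ> gen i \<circ> gen j) i"
  "descends D gen \<pi> (alternating 4 i j) \<longleftrightarrow> D \<pi> i \<and> D (\<pi> \<circ> gen i) j \<and> D (\<pi> \<circ> gen i \<circ> gen j) i
     \<and> D (\<pi> \<circ> gen i \<circ> gen j \<circ> gen i) j"
  by (simp_all add: descends_def numeral_eq_Suc)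

lemma sA_involution: "sA i \<circ> sA i = id"
  by (auto simp: sA_def fun_eq_iff)

lemma sA_braid: "word_prod sA (alternating (mA i j) i j) = word_prod sA (alternating (mA i j) j i)"
  by (auto simp: mA_def sA_def fun_eq_iff numeral_eq_Suc)

lemma less_cases_B:
  fixes i j :: nat
  assumes "1 \<le> i" "i < j"
  shows "i = 1 \<and> j = 2 \<or> i = 1 \<and> 2 < j \<or> 1 < i \<and> j = Suc i \<or> 1 < i \<and> Suc i < j"
  using assms by linarith

lemma less_cases_D:
  fixes i j :: nat
  assumes "1 \<le> i" "i < j"
  shows "i = 1 \<and> j = 2 \<or> i = 1 \<and> j = 3 \<or> i = 1 \<and> 3 < j \<or> 1 < i \<and> j = Suc i \<or> 1 < i \<and> Suc i < j"
  using assms by linarith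

lemma exchange_system_B: "exchange_system sB n mB (\<lambda>\<pi> i. \<pi> (int i) < \<pi> (aBD i))"
proof (rule B.exchange_systemI)
  fix i j :: nat assume ij: "i \<in> {1..n}" "j \<in> {1..n}" "i \<noteq> j"
  show "0 < mB i j" by (simp add: mB_def mA_def)
  have sym: "mB i j = mB j i" for i j by (auto simp: mB_def mA_def insert_commute)
  have "word_prod sB (alternating (mB i j) i j) = word_prod sB (alternating (mB i j) j i)"
    if ij': "1 \<le> i" "i < j" for i j
  proof -
    consider "i = 1" "j = 2" | "i = 1" "j > 2" | "i > 1" "j = Suc i" | "i > 1" "j > Suc i"
      using less_cases_B[OF ij'] by blast
    then show ?thesis
      by cases (auto simp: mB_def mA_def sB_signed_swap signed_swap_def aBD_def fun_eq_iff
          numeral_eq_Suc doubleton_eq_iff)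
  qed
  from this[of i j] this[of j i] show "word_prod sB (alternating (mB i j) i j) = word_prod sB (alternating (mB i j) j i)"
    using ij sym[of i j] by (cases i j rule: linorder_cases) auto
next
  fix \<pi> :: "int \<Rightarrow> int" and i j :: nat
  assume ij: "odd_map \<pi>" "i \<in> {1..n}" "j \<in> {1..n}" "i \<noteq> j"
    "\<pi> (int i) < \<pi> (aBD i)" "\<pi> (int j) < \<pi> (aBD j)"
  have odd: "\<pi> (- k) = - \<pi> k" for k using ij(1) by (simp add: odd_map_def)
  have "1 \<le> i" "1 \<le> j" "i < j \<or> j < i" using ij by auto
  then consider "i = 1" "j = 2" | "i = 1" "j > 2" | "i > 1" "j = Suc i" | "i > 1" "j > Suc i"
    | "j = 1" "i = 2" | "j = 1" "i > 2" | "j > 1" "i = Suc j" | "j > 1" "i > Suc j"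
    using less_cases_B[of i j] less_cases_B[of j i] by blast
  \<comment> \<open>Negative arguments of \<pi> enter only through the letter 1 and lie among -1 and
    -2; oddness there turns each case into linear inequalities between values of \<pi>.\<close>
  then show "descends (\<lambda>\<pi> i. \<pi> (int i) < \<pi> (aBD i)) sB \<pi> (alternating (mB i j) i j)"
    using ij(2,3,5,6) odd[of 1] odd[of 2]
    by cases (simp_all add: descends_alternating mB_def mA_def sB_signed_swap signed_swap_def aBD_def
          doubleton_eq_iff)
qed

lemma exchange_system_D: "exchange_system sD n mD (\<lambda>\<pi> i. \<pi> (bD i) < \<pi> (aBD i))"
proof (rule D.exchange_systemI)
  fix i j :: nat assume ij: "i \<in> {1..n}" "j \<in> {1..n}" "i \<noteq> j"
  show "0 < mD i j" by (simp add: mD_def mA_def)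
  have sym: "mD i j = mD j i" for i j by (auto simp: mD_def mA_def insert_commute)
  have "word_prod sD (alternating (mD i j) i j) = word_prod sD (alternating (mD i j) j i)"
    if ij': "1 \<le> i" "i < j" for i j
  proof -
    consider "i = 1" "j = 2" | "i = 1" "j = 3" | "i = 1" "j > 3" | "i > 1" "j = Suc i" | "i > 1" "j > Suc i"
      using less_cases_D[OF ij'] by blast
    then show ?thesis
      by cases (auto simp: mD_def mA_def sD_signed_swap signed_swap_def aBD_def bD_def fun_eq_iff
          numeral_eq_Suc doubleton_eq_iff)
  qed
  from this[of i j] this[of j i] show "word_prod sD (alternating (mD i j) i j) = word_prod sD (alternating (mD i j) j i)"
    using ij sym[of i j] by (cases i j rule: linorder_cases) auto
next
  fix \<pi> :: "int \<Rightarrow> int" and i j :: nat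
  assume ij: "odd_map \<pi>" "i \<in> {1..n}" "j \<in> {1..n}" "i \<noteq> j"
    "\<pi> (bD i) < \<pi> (aBD i)" "\<pi> (bD j) < \<pi> (aBD j)"
  have odd: "\<pi> (- k) = - \<pi> k" for k using ij(1) by (simp add: odd_map_def)
  have "1 \<le> i" "1 \<le> j" "i < j \<or> j < i" using ij by auto
  then consider "i = 1" "j = 2" | "i = 1" "j = 3" | "i = 1" "j > 3" | "i > 1" "j = Suc i" | "i > 1" "j > Suc i"
    | "j = 1" "i = 2" | "j = 1" "i = 3" | "j = 1" "i > 3" | "j > 1" "i = Suc j" | "j > 1" "i > Suc j"
    using less_cases_D[of i j] less_cases_D[of j i] by blast
  \<comment> \<open>As in type B, but the letters 1 and 3 together also reach -3, so oddness is used
    at 3 as well.\<close>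
  then show "descends (\<lambda>\<pi> i. \<pi> (bD i) < \<pi> (aBD i)) sD \<pi> (alternating (mD i j) i j)"
    using ij(2,3,5,6) odd[of 1] odd[of 2] odd[of 3]
    by cases (simp_all add: descends_alternating mD_def mA_def sD_signed_swap signed_swap_def aBD_def bD_def
          doubleton_eq_iff)
qed


section \<open>The action of the type A bialgebra\<close>

lemma low_part_alternating:
  "i \<le> n \<Longrightarrow> j \<le> n \<Longrightarrow> low_part n (alternating m i j) = alternating m i j"
  "n < i \<Longrightarrow> n < j \<Longrightarrow> low_part n (alternating m i j) = []"
  by (induction m arbitrary: i j) (auto simp: low_part_def)

lemma high_part_alternating:
  "i \<le> n \<Longrightarrow> j \<le> n \<Longrightarrow> high_part n (alternating m i j) = []"
  "n < i \<Longrightarrow> n < j \<Longrightarrow> high_part n (alternating m i j) = alternating m (i - n) (j - n)"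
  by (induction m arbitrary: i j) (auto simp: high_part_def)

lemma mA_shift: "n < i \<Longrightarrow> n < j \<Longrightarrow> mA (i - n) (j - n) = mA i j"
  by (auto simp: mA_def)

definition product_words :: "(nat \<Rightarrow> 'b \<Rightarrow> 'b) \<Rightarrow> nat \<Rightarrow> ('b \<Rightarrow> 'b) \<Rightarrow> nat \<Rightarrow> (nat \<Rightarrow> nat) \<Rightarrow> nat list set" where
  "product_words gen n \<pi> k \<sigma> =
    {z. low_part n z \<in> reduced_words gen n \<pi> \<and> high_part n z \<in> reduced_words sA k \<sigma>}"

lemma product_words_set: "z \<in> product_words gen n \<pi> k \<sigma> \<Longrightarrow> set z \<subseteq> {1..n + k}"
  unfolding product_words_def
  by (rule set_subset_low_high) (blast dest: reduced_wordsD(1))+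

lemma finite_product_words: "finite (product_words gen n \<pi> k \<sigma>)"
proof (cases "product_words gen n \<pi> k \<sigma> = {}")
  case False
  then obtain w where w: "w \<in> product_words gen n \<pi> k \<sigma>" by auto
  have "length z = length w" if "z \<in> product_words gen n \<pi> k \<sigma>" for z
    using w that reduced_words_same_length length_low_high[of n z] length_low_high[of n w]
    unfolding product_words_def by (metis (no_types, lifting) mem_Collect_eq)
  then have "product_words gen n \<pi> k \<sigma> \<subseteq> {v. set v \<subseteq> {1..n + k} \<and> length v \<le> length w}"
    using product_words_set by fastforce
  then show ?thesis using finite_words_bounded finite_subset by blast
qed simp

lemma Wmult_perm_elem:
  fixes gen :: "nat \<Rightarrow> 'b \<Rightarrow> 'b"
  shows "Wmult (perm_elem gen n \<pi>) (perm_elem sA k \<sigma>) =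
    (\<lambda>x. if snd x = n + k \<and> fst x \<in> product_words gen n \<pi> k \<sigma> then 1 else (0::'a::field_char_0))"
proof
  fix x :: wbasis
  obtain z N where x: "x = (z, N)" by (cases x)
  have "Wmult (perm_elem gen n \<pi>) (perm_elem sA k \<sigma>) (z, N) = (\<Sum>m\<le>N. if m = n then
      (if N = n + k \<and> z \<in> product_words gen n \<pi> k \<sigma> then 1 else (0::'a)) else 0)"
    unfolding Wmult_eq[OF perm_elem_in_Wsp perm_elem_in_Wsp]
    by (intro sum.cong refl) (auto simp: perm_elem_def product_words_def)
  then show "Wmult (perm_elem gen n \<pi>) (perm_elem sA k \<sigma>) x =
      (if snd x = n + k \<and> fst x \<in> product_words gen n \<pi> k \<sigma> then 1 else (0::'a))"
    by (auto simp: x)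
qed

context exchange_system
begin

text \<open>Two equal adjacent letters fall into the same part and stay adjacent there, but a
  reduced word contains no such square.\<close>

lemma product_words_no_square:
  assumes "n0 \<le> n"
  shows "p @ i # i # q \<notin> product_words gen n0 \<pi> k \<sigma>"
proof
  assume *: "p @ i # i # q \<in> product_words gen n0 \<pi> k \<sigma>"
  show False
  proof (cases "i \<le> n0")
    case True
    then have r: "low_part n0 p @ i # i # low_part n0 q \<in> reduced_words gen n0 \<pi>"
      using * by (simp add: product_words_def low_part_def)
    then have "i \<in> {1..n}" using reduced_wordsD(1)[OF r] assms by auto
    then show False using reduced_words_no_square[of gen i] involution r by blast
  next
    case False
    then have "high_part n0 p @ (i - n0) # (i - n0) # high_part n0 q \<in> reduced_words sA k \<sigma>"
      using * by (simp add: product_words_def high_part_def)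
    then show False using reduced_words_no_square[of sA, OF sA_involution] by blast
  qed
qed

text \<open>A braid relation of length at least three between a low and a high letter never applies:
  one of the two parts of the word would have a repeated letter.\<close>

lemma product_words_braid_closed:
  assumes n: "n = n0 + k"
    and m: "\<And>i j. m i j \<in> {2, 3, 4}" "\<And>i j. n0 < i \<Longrightarrow> n0 < j \<Longrightarrow> m i j = mA i j"
  shows "braid_closed n m (product_words gen n0 \<pi> k \<sigma>)"
  unfolding braid_closed_def
proof (intro allI impI)
  fix p q :: "nat list" and i j :: nat
  assume i: "i \<in> {1..n}" and j: "j \<in> {1..n}" and ij: "i \<noteq> j"
    and z: "p @ alternating (m i j) i j @ q \<in> product_words gen n0 \<pi> k \<sigma>"
  let ?a = "alternating (m i j) i j" and ?b = "alternating (m i j) j i"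
  let ?l = "low_part n0" and ?h = "high_part n0"
  have low: "?l p @ ?l ?a @ ?l q \<in> reduced_words gen n0 \<pi>"
    and high: "?h p @ ?h ?a @ ?h q \<in> reduced_words sA k \<sigma>"
    using z by (auto simp: product_words_def)
  have "?l p @ ?l ?b @ ?l q \<in> reduced_words gen n0 \<pi> \<and> ?h p @ ?h ?b @ ?h q \<in> reduced_words sA k \<sigma>"
  proof (cases "i \<le> n0 \<longleftrightarrow> j \<le> n0")
    case True
    show ?thesis
    proof (cases "i \<le> n0")
      case le: True
      have ab: "?l ?a = ?a" "?l ?b = ?b" "?h ?a = []" "?h ?b = []"
        using le True low_part_alternating(1) high_part_alternating(1) by auto
      have "?l p @ ?b @ ?l q \<in> reduced_words gen n0 \<pi>"
      proof (rule reduced_words_replace_factor)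
        show "?l p @ ?a @ ?l q \<in> reduced_words gen n0 \<pi>" using low ab by simp
        show "set ?b \<subseteq> {1..n0}" by (rule order_trans[OF set_alternating]) (use le True i j in auto)
      qed (use braid_relation[OF i j ij] in auto)
      then show ?thesis using high ab by simp
    next
      case gt: False
      then have ij0: "n0 < i" "n0 < j" using True by auto
      have ab: "?l ?a = []" "?l ?b = []" "?h ?a = alternating (m i j) (i - n0) (j - n0)"
        "?h ?b = alternating (m i j) (j - n0) (i - n0)"
        using low_part_alternating(2) high_part_alternating(2) ij0 by auto
      \<comment> \<open>Above \<open>n0\<close> the Coxeter matrix is that of type A, which depends
        only on the difference of the letters and so survives the shift.\<close>
      have mm: "m i j = mA (i - n0) (j - n0)" using m(2)[OF ij0] mA_shift[OF ij0] by simp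
      have "?h p @ ?h ?b @ ?h q \<in> reduced_words sA k \<sigma>"
      proof (rule reduced_words_replace_factor[OF high])
        show "set (?h ?b) \<subseteq> {1..k}"
          unfolding ab by (rule order_trans[OF set_alternating]) (use ij0 i j n in auto)
        show "word_prod sA (?h ?b) = word_prod sA (?h ?a)" 
          using sA_braid[of "i - n0" "j - n0"] unfolding ab mm[symmetric] by simp
      qed (simp add: ab)
      then show ?thesis using low ab by simp
    qed
  next
    case False
    have m2: "m i j = 2"
    proof (rule ccontr)
      assume "m i j \<noteq> 2"
      then obtain v where v: "?a = v @ [i, j, i]" using m(1)[of i j]
        by (auto simp: numeral_eq_Suc)
      show False
      proof (cases "i \<le> n0")
        case True
        then have "(?l p @ ?l v) @ i # i # ?l q \<in> reduced_words gen n0 \<pi>"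
          using low False unfolding v by (simp add: low_part_def)
        then show False using reduced_words_no_square[of gen i, OF involution[OF i]] by blast
      next
        case gt: False
        then have "(?h p @ ?h v) @ (i - n0) # (i - n0) # ?h q \<in> reduced_words sA k \<sigma>"
          using high False unfolding v by (simp add: high_part_def)
        then show False using reduced_words_no_square[of sA, OF sA_involution] by blast
      qed
    qed
    \<comment> \<open>The remaining mixed move swaps a low letter with an adjacent high one, which
      neither part notices.\<close>
    have "?l ?b = ?l ?a" "?h ?b = ?h ?a"
      using False unfolding m2 by (auto simp: numeral_eq_Suc low_part_def high_part_def)
    then show ?thesis using low high by simp
  qed
  then show "p @ ?b @ q \<in> product_words gen n0 \<pi> k \<sigma>" by (simp add: product_words_def)
qed

end

section \<open>Bilinearity and closure of the spans\<close>

lemma Wmult_lincomb_left: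
  assumes "f \<in> Wsp" "g \<in> Wsp" "h \<in> Wsp"
  shows "Wmult (\<lambda>x. c * f x + g x) h = (\<lambda>x. c * Wmult f h x + Wmult g h x)"
proof
  fix x :: wbasis
  obtain z N where x: "x = (z, N)" by (cases x)
  show "Wmult (\<lambda>x. c * f x + g x) h x = c * Wmult f h x + Wmult g h x"
    unfolding x Wmult_eq[OF assms(1,3)] Wmult_eq[OF assms(2,3)]
      Wmult_eq[OF Wsp_lincomb[OF assms(1,2)] assms(3)]
    by (simp add: algebra_simps sum.distrib sum_distrib_left)
qed

lemma Wmult_lincomb_right:
  assumes "f \<in> Wsp" "g \<in> Wsp" "h \<in> Wsp"
  shows "Wmult h (\<lambda>x. c * f x + g x) = (\<lambda>x. c * Wmult h f x + Wmult h g x)"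
proof
  fix x :: wbasis
  obtain z N where x: "x = (z, N)" by (cases x)
  show "Wmult h (\<lambda>x. c * f x + g x) x = c * Wmult h f x + Wmult h g x"
    unfolding x Wmult_eq[OF assms(3,1)] Wmult_eq[OF assms(3,2)]
      Wmult_eq[OF assms(3) Wsp_lincomb[OF assms(1,2)]]
    by (simp add: algebra_simps sum.distrib sum_distrib_left)
qed

lemma Wmult_kspan:
  assumes S: "S \<subseteq> Wsp" "T \<subseteq> Wsp" and ST: "\<And>f g. f \<in> S \<Longrightarrow> g \<in> T \<Longrightarrow> Wmult f g \<in> kspan U"
    and f: "f \<in> kspan S" and g: "g \<in> kspan T"
  shows "Wmult f g \<in> kspan U"
proof -
  note W = subsetD[OF kspan_subset_Wsp]
  have zero: "Wmult (\<lambda>_. 0) h = 0" "Wmult h (\<lambda>_. 0) = 0" for h :: "wbasis \<Rightarrow> 'a"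
    by (simp_all add: Wmult_def supp_def fun_eq_iff)
  have *: "Wmult s g \<in> kspan U" if "s \<in> S" for s
    using g
  proof (induction rule: kspan_induct)
    case (step c t h)
    then show ?case
      using S that ST[of s t] W[OF S(2), of h]
      by (subst Wmult_lincomb_right) (auto intro!: kspan_lincomb)
  qed (simp add: zero kspan_zero del: zero_fun_apply)
  show ?thesis using f
  proof (induction rule: kspan_induct)
    case (step c s h)
    then show ?case
      using S *[of s] W[OF S(1), of h] W[OF S(2) g]
      by (subst Wmult_lincomb_left) (auto intro!: kspan_lincomb)
  qed (simp add: zero kspan_zero del: zero_fun_apply)
qed

lemma PiA_in_Wsp: "PiA \<subseteq> Wsp"
  unfolding PiA_def by (intro kspan_subset_Wsp) (auto simp: perm_elem_in_Wsp)

text \<open>Bilinearity reduces closure under the action to products of basis elements. The set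
  \<open>I\<close> has to be upward closed because such a product has rank
  \<open>n + k\<close>.\<close>

lemma graded_right_module_coalgebra_perm_elem:
  fixes gen :: "nat \<Rightarrow> 'b \<Rightarrow> 'b" and G :: "nat \<Rightarrow> ('b \<Rightarrow> 'b) set" and I :: "nat set"
  defines "M \<equiv> kspan {perm_elem gen n \<pi> | n \<pi>. n \<in> I \<and> \<pi> \<in> G n} :: (wbasis \<Rightarrow> 'a::field_char_0) set"
  assumes G: "\<And>n w. n \<in> I \<Longrightarrow> set w \<subseteq> {1..n} \<Longrightarrow> word_prod gen w \<in> G n"
    and sys: "\<And>n. exchange_system gen n m D"
    and I: "\<And>n k. n \<in> I \<Longrightarrow> n + k \<in> I"
    and m: "\<And>i j. m i j \<in> {2, 3, 4}"
      "\<And>n i j. n \<in> I \<Longrightarrow> n < i \<Longrightarrow> n < j \<Longrightarrow> m i j = mA i j"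
  shows "graded_right_module_coalgebra M PiA"
proof -
  let ?S = "{perm_elem gen n \<pi> | n \<pi>. n \<in> I \<and> \<pi> \<in> G n} :: (wbasis \<Rightarrow> 'a::field_char_0) set"
  have S: "?S \<subseteq> Wsp" by (auto simp: perm_elem_in_Wsp)
  have M: "M \<subseteq> Wsp" unfolding M_def using S by (rule kspan_subset_Wsp)
  let ?T = "{perm_elem sA n \<pi> |n \<pi>. \<pi> permutes {1..n + 1}} :: (wbasis \<Rightarrow> 'a) set"
  have T: "?T \<subseteq> Wsp" by (auto simp: perm_elem_in_Wsp)
  have "Wmult f g \<in> kspan ?S" if "f \<in> ?S" "g \<in> ?T" for f g
  proof -
    from that obtain n \<pi> k \<sigma> where f: "f = perm_elem gen n \<pi>" and n: "n \<in> I" and g: "g = perm_elem sA k \<sigma>"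
      by auto
    \<comment> \<open>The word property is invoked in the large group of rank \<open>n + k\<close>,
      where the product lives.\<close>
    interpret exchange_system gen "n + k" m D by (rule sys)
    let ?L = "product_words gen n \<pi> k \<sigma>"
    have "Wmult f g = (\<Sum>\<pi>\<in>word_prod gen ` ?L. perm_elem gen (n + k) \<pi>)"
      unfolding f g Wmult_perm_elem
      by (rule braid_closed_indicator[OF product_words_braid_closed[OF refl m(1) m(2)[OF n]]
            product_words_no_square finite_product_words product_words_set]) auto
    also have "\<dots> \<in> kspan ?S"
      using G[OF I[OF n]] I[OF n] product_words_set by (intro kspan_sum kspan_base) blast
    finally show "Wmult f g \<in> kspan ?S" .
  qed
  then have "Wmult f g \<in> M" if "f \<in> M" "g \<in> PiA" for f g
    using Wmult_kspan[OF S T] that unfolding M_def PiA_def by blast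
  moreover have "graded_subcoalgebra M"
    unfolding M_def by (rule graded_subcoalgebra_perm_elem[OF G])
  ultimately show ?thesis
    unfolding graded_right_module_coalgebra_def
    using M PiA_in_Wsp[where 'a='a]
    by (auto intro!: Wmult_assoc Wmult_Wunit homog_Wmult Wcop_Wmult Wcounit_Wmult)
qed

text \<open>\<open>Bgrp\<close> is defined by permutations rather than by generators, so membership
  of products of letters needs this argument; for \<open>Dgrp\<close> it is the definition.\<close>

lemma word_prod_sB_in_Bgrp:
  assumes "set w \<subseteq> {1..n}" shows "word_prod sB w \<in> Bgrp n"
proof -
  let ?S = "{k. k \<noteq> 0 \<and> \<bar>k\<bar> \<le> int n}"
  have gen: "sB i permutes ?S" if i: "i \<in> {1..n}" for i
  proof -
    have "sB i (sB i k) = k" for k using B.gen_involution[OF i] by (simp add: fun_eq_iff)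
    moreover have "sB i k = k" if "k \<notin> ?S" for k
      using i that by (auto simp: sB_signed_swap signed_swap_def aBD_def)
    ultimately show ?thesis unfolding permutes_def by metis
  qed
  have "word_prod sB w permutes ?S"
    using assms by (induction w) (auto intro!: permutes_compose gen simp: permutes_id[unfolded id_def] id_def)
  then show ?thesis using B.word_prod_odd[OF assms] by (auto simp: Bgrp_def odd_map_def)
qed

theorem theorem6p6:
  shows "graded_subcoalgebra (PiB :: (wbasis \<Rightarrow> 'a::field_char_0) set)
       \<and> graded_subcoalgebra (PiD :: (wbasis \<Rightarrow> 'a) set)
       \<and> graded_right_module_coalgebra (PiB :: (wbasis \<Rightarrow> 'a) set) PiA
       \<and> graded_right_module_coalgebra (PiD :: (wbasis \<Rightarrow> 'a) set) PiA"
proof -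
  \<comment> \<open>With \<open>n\<close> in \<open>{1..}\<close>, and below in
    \<open>{2..}\<close>, no high letter equals 1, so the exceptional entries of \<open>mB\<close>
    and \<open>mD\<close> never occur between high letters.\<close>
  have "graded_right_module_coalgebra (kspan {perm_elem sB n \<pi> | n \<pi>. n \<in> {1..} \<and> \<pi> \<in> Bgrp n})
      (PiA :: (wbasis \<Rightarrow> 'a) set)"
    by (rule graded_right_module_coalgebra_perm_elem[OF word_prod_sB_in_Bgrp exchange_system_B])
      (auto simp: mB_def mA_def doubleton_eq_iff)
  moreover have "graded_right_module_coalgebra (kspan {perm_elem sD n \<pi> | n \<pi>. n \<in> {2..} \<and> \<pi> \<in> Dgrp n})
      (PiA :: (wbasis \<Rightarrow> 'a) set)"
    by (rule graded_right_module_coalgebra_perm_elem[OF _ exchange_system_D])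
      (auto simp: Dgrp_def mD_def mA_def doubleton_eq_iff)
  ultimately show ?thesis
    by (simp add: PiB_def PiD_def graded_right_module_coalgebra_def)
qed

end
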